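(* Assume the setting and Hypotheses (A), (B), (C) described in the context, and let $\hat f_\theta$, $G_\theta$, $\hat K(\theta)$ be as defined there. For each $\theta\in\Theta$, $$\hat f_\theta(\hat K(\theta))=\hat K(S\theta),\qquad f_\theta=G_{S\theta}^{-1}\circ\hat f_\theta\circ G_\theta\ \text{ on } K(\theta),$$ and the map $\hat f_\theta$ depends on $\theta$ only through $\Pi(S\theta)\in\mathbb{T}^1$. If $\theta\notin P$, then $\hat f_\theta:\hat K(\theta)\to\hat K(S\theta)$ is an orientation preserving diffeomorphism (with one-sided derivatives at the endpoints).
   Context: Setting. $(\Theta,d)$ is a compact metric space, $S:\Theta\to\Theta$ is a Borel measurable invertible map, $\mathbb{I}=[-M,M]$ is a compact interval, and $F(\theta,y)=(S\theta,f_\theta(y))$ is a skew product on $\Theta\times\mathbb{I}$ whose fibre maps $f_\theta:\mathbb{I}\to(-M,M)$ are uniformly bounded increasing $C^3$ maps with $\inf_{(\theta,y)}f_\theta'(y)>0$ and $\sup_{(\theta,y)}\mathcal{S}f_\theta(y)<0$, where primes denote derivatives in $y$ and $\mathcal{S}f_\theta=\frac{f_\theta'''}{f_\theta'}-\frac32\big(\frac{f_\theta''}{f_\theta'}\big)^2$. Write $f_\theta^n=f_{S^{n-1}\theta}\circ\cdots\circ f_\theta$ (a map on $\mathbb{I}$), and $(f^n_\theta)^{-1}$ for its inverse, defined on $f^n_\theta(\mathbb{I})$. Bounding graphs. $\phi_n^{\pm}(\theta):=f^n_{S^{-n}\theta}(\pm M)$ and $\phi^{\pm}(\theta):=\lim_{n\to\infty}\phi_n^{\pm}(\theta)$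 (monotone limits: $\phi_n^-\nearrow\phi^-$, $\phi_n^+\searrow\phi^+$). $K_n(\theta):=[\phi_n^-(\theta),\phi_n^+(\theta)]$, $K(\theta):=[\phi^-(\theta),\phi^+(\theta)]$. The set of pinch points is $P:=\{\theta\in\Theta:\phi^+(\theta)=\phi^-(\theta)\}$. Hypothesis (A): there is $L$ such that for all $\theta,\theta'\in\Theta$, $\sup_{y\in\mathbb{I}}|f_\theta(y)-f_{\theta'}(y)|+\sup_{y\in\mathbb{I}}|f'_\theta(y)-f'_{\theta'}(y)|\le L\,d(\theta,\theta')$. Hypothesis (B): there is a piecewise expanding and piecewise $C^{1+}$ (i.e. $C^1$ with Hölder continuous derivative) mixing Markov map $\hat S:\mathbb{T}^1\to\mathbb{T}^1$ with finitely many branches, and a measurable $\Pi:\Theta\to\mathbb{T}^1$ with $\hat S\circ\Pi=\Pi\circ S^{-1}$; there is an injection $\sigma:\mathbb{T}^1\to\Theta$, Hölder continuous on monotonicity intervals of $\hat S$, with $\Pi\circ\sigma=\mathrm{id}_{\mathbb{T}^1}$; and there are $C>0$, $\alpha\in(0,1)$ such that for all $\theta\in\Theta$ and $n>0$, $d(S^{-n}\theta,S^{-n}(\sigma\Pi\theta))\le C\alpha^n d(\theta,\sigma\Pi\theta)$. Hypothesis (C): with $Q_f:=\sup_{(\theta,y)}f'_\theta(y)$ and $Q'_f:=\sup_{(\theta,y)}|(\log f'_\theta(y))'|$, one has $\alpha Q_f<1$ and $Q'_f<\infty$. Fibre maps $G$. A point $\theta'$ belongs to the local stable fibre of $\theta$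 if $d(S^{-n}\theta,S^{-n}\theta')\le C\alpha^n d(\theta,\theta')$ for all $n>0$. For such $\theta,\theta'$ put $G_{\theta,\theta',n}:=f^n_{S^{-n}\theta'}\circ(f^n_{S^{-n}\theta})^{-1}:K_n(\theta)\to K_n(\theta')$ and $G_{\theta,\theta'}:=\lim_{n\to\infty}G_{\theta,\theta',n}$; this limit exists uniformly on $K(\theta)$ and is an increasing homeomorphism $K(\theta)\to K(\theta')$ (a diffeomorphism, with one-sided derivatives at the endpoints, if $\theta\notin P$). Put $G_\theta:=G_{\theta,\sigma\Pi\theta}$. New system. $\hat\phi^{\pm}(\theta):=G_\theta(\phi^{\pm}(\theta))$, $\hat K(\theta):=[\hat\phi^-(\theta),\hat\phi^+(\theta)]=K(\sigma\Pi\theta)$, and $\hat f_\theta:=f_{S^{-1}(\sigma\Pi S\theta)}\circ G_{\sigma\Pi\theta,\,S^{-1}\sigma\Pi S\theta}$ on $\hat K(\theta)$ (well defined because $\sigma\Pi(S^{-1}\sigma\Pi S\theta)=\sigma\Pi\theta$, so by (B) the two points lie in the same local stable fibre). *)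

theory Defs
  imports "HOL-Analysis.Analysis"
begin

text \<open>Derivatives on a compact interval are taken relative to the interval, so they are one-sided
  at its endpoints.\<close>

definition deriv_on :: "real set \<Rightarrow> (real \<Rightarrow> real) \<Rightarrow> real \<Rightarrow> real" where
  "deriv_on X g y = vector_derivative g (at y within X)"

definition Ck_on :: "nat \<Rightarrow> real set \<Rightarrow> (real \<Rightarrow> real) \<Rightarrow> bool" where
  "Ck_on k X g \<longleftrightarrow>
     (\<forall>j<k. (deriv_on X ^^ j) g differentiable_on X) \<and> continuous_on X ((deriv_on X ^^ k) g)"

definition schwarzian_on :: "real set \<Rightarrow> (real \<Rightarrow> real) \<Rightarrow> real \<Rightarrow> real" where
  "schwarzian_on X g y =
     (deriv_on X ^^ 3) g y / deriv_on X g y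
       - 3 / 2 * ((deriv_on X ^^ 2) g y / deriv_on X g y)\<^sup>2"

definition diffeo_on :: "real set \<Rightarrow> real set \<Rightarrow> (real \<Rightarrow> real) \<Rightarrow> bool" where
  "diffeo_on X Y g \<longleftrightarrow> bij_betw g X Y \<and> Ck_on 1 X g \<and> Ck_on 1 Y (inv_into X g)"

definition orientation_preserving_diffeo_on ::
    "real set \<Rightarrow> real set \<Rightarrow> (real \<Rightarrow> real) \<Rightarrow> bool" where
  "orientation_preserving_diffeo_on X Y g \<longleftrightarrow> diffeo_on X Y g \<and> strict_mono_on X g"

definition hoelder_on :: "'a::metric_space set \<Rightarrow> ('a \<Rightarrow> 'b::metric_space) \<Rightarrow> bool" where
  "hoelder_on X g \<longleftrightarrow>
     (\<exists>H \<beta>. 0 < \<beta> \<and> \<beta> \<le> 1 \<and> (\<forall>x\<in>X. \<forall>y\<in>X. dist (g x) (g y) \<le> H * dist x y powr \<beta>))"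

text \<open>The compact metric space \<open>\<Theta>\<close> is the whole type \<^typ>\<open>'a\<close>. Fibre maps are total functions
  on the reals of which only the restriction to \<open>{-M..M}\<close> matters. Suprema and infima over
  \<open>\<Theta> \<times> {-M..M}\<close> are taken in the extended reals, since they need not be finite a priori.\<close>

definition skew_product ::
    "('a::metric_space \<Rightarrow> 'a) \<Rightarrow> real \<Rightarrow> ('a \<Rightarrow> real \<Rightarrow> real) \<Rightarrow> bool" where
  "skew_product S M f \<longleftrightarrow>
     compact (UNIV :: 'a set) \<and>
     bij S \<and> S \<in> borel_measurable borel \<and>
     0 < M \<and>
     (\<forall>\<theta>. f \<theta> ` {-M..M} \<subseteq> {-M<..<M} \<and> strict_mono_on {-M..M} (f \<theta>) \<and> Ck_on 3 {-M..M} (f \<theta>)) \<and>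
     0 < (INF (\<theta>, y) \<in> UNIV \<times> {-M..M}. ereal (deriv_on {-M..M} (f \<theta>) y)) \<and>
     (SUP (\<theta>, y) \<in> UNIV \<times> {-M..M}. ereal (schwarzian_on {-M..M} (f \<theta>) y)) < 0"

primrec fibre_iter ::
    "('a \<Rightarrow> 'a) \<Rightarrow> ('a \<Rightarrow> real \<Rightarrow> real) \<Rightarrow> nat \<Rightarrow> 'a \<Rightarrow> real \<Rightarrow> real" where
  "fibre_iter S f 0 \<theta> = id"
| "fibre_iter S f (Suc n) \<theta> = f ((S ^^ n) \<theta>) \<circ> fibre_iter S f n \<theta>"

definition pullback_fibre_iter ::
    "('a \<Rightarrow> 'a) \<Rightarrow> ('a \<Rightarrow> real \<Rightarrow> real) \<Rightarrow> nat \<Rightarrow> 'a \<Rightarrow> real \<Rightarrow> real" where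
  "pullback_fibre_iter S f n \<theta> = fibre_iter S f n ((inv S ^^ n) \<theta>)"

definition phi_minus :: "('a \<Rightarrow> 'a) \<Rightarrow> real \<Rightarrow> ('a \<Rightarrow> real \<Rightarrow> real) \<Rightarrow> 'a \<Rightarrow> real" where
  "phi_minus S M f \<theta> = lim (\<lambda>n. pullback_fibre_iter S f n \<theta> (- M))"

definition phi_plus :: "('a \<Rightarrow> 'a) \<Rightarrow> real \<Rightarrow> ('a \<Rightarrow> real \<Rightarrow> real) \<Rightarrow> 'a \<Rightarrow> real" where
  "phi_plus S M f \<theta> = lim (\<lambda>n. pullback_fibre_iter S f n \<theta> M)"

definition K :: "('a \<Rightarrow> 'a) \<Rightarrow> real \<Rightarrow> ('a \<Rightarrow> real \<Rightarrow> real) \<Rightarrow> 'a \<Rightarrow> real set" where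
  "K S M f \<theta> = {phi_minus S M f \<theta>..phi_plus S M f \<theta>}"

definition pinch_points :: "('a \<Rightarrow> 'a) \<Rightarrow> real \<Rightarrow> ('a \<Rightarrow> real \<Rightarrow> real) \<Rightarrow> 'a set" where
  "pinch_points S M f = {\<theta>. phi_plus S M f \<theta> = phi_minus S M f \<theta>}"

definition local_stable_fibre ::
    "('a::metric_space \<Rightarrow> 'a) \<Rightarrow> real \<Rightarrow> real \<Rightarrow> 'a \<Rightarrow> 'a set" where
  "local_stable_fibre S C \<alpha> \<theta> =
     {\<theta>'. \<forall>n>0. dist ((inv S ^^ n) \<theta>) ((inv S ^^ n) \<theta>') \<le> C * \<alpha> ^ n * dist \<theta> \<theta>'}"

text \<open>The circle \<open>\<real>/\<int>\<close> is realised as the unit circle of the complex plane through \<open>circle_proj\<close>.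
  The chordal metric is Lipschitz equivalent to arc length, which does not affect Hoelder
  conditions; derivatives are taken in the coordinate of \<open>\<real>/\<int>\<close>.\<close>

definition circle :: "complex set" where
  "circle = sphere 0 1"

definition circle_proj :: "real \<Rightarrow> complex" where
  "circle_proj t = cis (2 * pi * t)"

text \<open>The points \<open>a 0 < \<dots> < a N = a 0 + 1\<close> cut the circle into arcs. The interval \<open>J i\<close> is the
  \<open>i\<close>-th arc, with any choice of which of its endpoints belong to it.\<close>

definition arc_partition :: "nat \<Rightarrow> (nat \<Rightarrow> real) \<Rightarrow> (nat \<Rightarrow> complex set) \<Rightarrow> bool" where
  "arc_partition N a J \<longleftrightarrow>
     0 < N \<and> (\<forall>i<N. a i < a (Suc i)) \<and> a N = a 0 + 1 \<and>
     (\<forall>i<N. circle_proj ` {a i<..<a (Suc i)} \<subseteq> J i \<and> J i \<subseteq> circle_proj ` {a i..a (Suc i)}) \<and>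
     disjoint_family_on J {..<N} \<and> (\<Union>i<N. J i) = circle"

text \<open>On each \<open>J i\<close> the map \<open>T\<close> is given, in the coordinate of \<open>\<real>/\<int>\<close>, by a lift \<open>g\<close> defined up to
  the endpoints. The last conjunct is the Markov property.\<close>

definition expanding_markov_map ::
    "nat \<Rightarrow> (nat \<Rightarrow> real) \<Rightarrow> (nat \<Rightarrow> complex set) \<Rightarrow> (complex \<Rightarrow> complex) \<Rightarrow> bool" where
  "expanding_markov_map N a J T \<longleftrightarrow>
     arc_partition N a J \<and> T ` circle \<subseteq> circle \<and>
     (\<exists>r>1. \<forall>i<N. \<exists>g. let X = {a i..a (Suc i)} in
        Ck_on 1 X g \<and> hoelder_on X (deriv_on X g) \<and>
        (\<forall>t\<in>X. r \<le> \<bar>deriv_on X g t\<bar>) \<and>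
        (\<forall>t\<in>X. circle_proj t \<in> J i \<longrightarrow> T (circle_proj t) = circle_proj (g t))) \<and>
     (\<forall>i<N. inj_on T (circle_proj ` {a i<..<a (Suc i)})) \<and>
     (\<forall>i<N. \<forall>j<N.
        T ` circle_proj ` {a i<..<a (Suc i)} \<inter> circle_proj ` {a j<..<a (Suc j)} \<noteq> {} \<longrightarrow>
        circle_proj ` {a j<..<a (Suc j)} \<subseteq> T ` circle_proj ` {a i<..<a (Suc i)})"

definition top_mixing_on :: "'b::topological_space set \<Rightarrow> ('b \<Rightarrow> 'b) \<Rightarrow> bool" where
  "top_mixing_on X T \<longleftrightarrow>
     (\<forall>U V. open U \<and> open V \<and> U \<inter> X \<noteq> {} \<and> V \<inter> X \<noteq> {} \<longrightarrow>
        (\<exists>n0. \<forall>n\<ge>n0. (T ^^ n) ` (U \<inter> X) \<inter> (V \<inter> X) \<noteq> {}))"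

text \<open>The suprema here are over continuous functions on a compact interval, hence
  genuine real suprema.\<close>

definition hypothesis_A :: "real \<Rightarrow> ('a::metric_space \<Rightarrow> real \<Rightarrow> real) \<Rightarrow> bool" where
  "hypothesis_A M f \<longleftrightarrow>
     (\<exists>L. \<forall>\<theta> \<theta>'.
        (SUP y\<in>{-M..M}. \<bar>f \<theta> y - f \<theta>' y\<bar>) +
        (SUP y\<in>{-M..M}. \<bar>deriv_on {-M..M} (f \<theta>) y - deriv_on {-M..M} (f \<theta>') y\<bar>)
          \<le> L * dist \<theta> \<theta>')"

definition hypothesis_B ::
    "('a::metric_space \<Rightarrow> 'a) \<Rightarrow> (complex \<Rightarrow> complex) \<Rightarrow> ('a \<Rightarrow> complex) \<Rightarrow> (complex \<Rightarrow> 'a) \<Rightarrow>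
     real \<Rightarrow> real \<Rightarrow> bool" where
  "hypothesis_B S Shat \<pi> \<sigma> C \<alpha> \<longleftrightarrow>
     (\<exists>N a J. expanding_markov_map N a J Shat \<and> (\<forall>i<N. hoelder_on (J i) \<sigma>)) \<and>
     top_mixing_on circle Shat \<and>
     \<pi> \<in> measurable borel (restrict_space borel circle) \<and>
     (\<forall>\<theta>. Shat (\<pi> \<theta>) = \<pi> (inv S \<theta>)) \<and>
     inj_on \<sigma> circle \<and> (\<forall>x\<in>circle. \<pi> (\<sigma> x) = x) \<and>
     0 < C \<and> 0 < \<alpha> \<and> \<alpha> < 1 \<and>
     (\<forall>\<theta>. \<sigma> (\<pi> \<theta>) \<in> local_stable_fibre S C \<alpha> \<theta>)"

definition Q :: "real \<Rightarrow> ('a \<Rightarrow> real \<Rightarrow> real) \<Rightarrow> ereal" where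
  "Q M f = (SUP (\<theta>, y) \<in> UNIV \<times> {-M..M}. ereal (deriv_on {-M..M} (f \<theta>) y))"

definition Q' :: "real \<Rightarrow> ('a \<Rightarrow> real \<Rightarrow> real) \<Rightarrow> ereal" where
  "Q' M f = (SUP (\<theta>, y) \<in> UNIV \<times> {-M..M}.
     ereal \<bar>deriv_on {-M..M} (\<lambda>z. ln (deriv_on {-M..M} (f \<theta>) z)) y\<bar>)"

definition hypothesis_C :: "real \<Rightarrow> ('a \<Rightarrow> real \<Rightarrow> real) \<Rightarrow> real \<Rightarrow> bool" where
  "hypothesis_C M f \<alpha> \<longleftrightarrow> ereal \<alpha> * Q M f < 1 \<and> Q' M f < \<infinity>"

text \<open>\<open>Gn S M f \<theta> \<theta>' n\<close> is meaningful only on the image of \<open>{-M..M}\<close> under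
  \<open>pullback_fibre_iter S f n \<theta>\<close>, and \<open>G S M f \<theta> \<theta>'\<close> on
  \<^term>\<open>K S M f \<theta>\<close> only, for \<open>\<theta>'\<close> in the local stable fibre of \<open>\<theta>\<close>.\<close>

definition Gn ::
    "('a \<Rightarrow> 'a) \<Rightarrow> real \<Rightarrow> ('a \<Rightarrow> real \<Rightarrow> real) \<Rightarrow> 'a \<Rightarrow> 'a \<Rightarrow> nat \<Rightarrow> real \<Rightarrow> real" where
  "Gn S M f \<theta> \<theta>' n =
     pullback_fibre_iter S f n \<theta>' \<circ> inv_into {-M..M} (pullback_fibre_iter S f n \<theta>)"

definition G ::
    "('a \<Rightarrow> 'a) \<Rightarrow> real \<Rightarrow> ('a \<Rightarrow> real \<Rightarrow> real) \<Rightarrow> 'a \<Rightarrow> 'a \<Rightarrow> real \<Rightarrow> real" where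
  "G S M f \<theta> \<theta>' y = lim (\<lambda>n. Gn S M f \<theta> \<theta>' n y)"

definition Gproj ::
    "('a \<Rightarrow> 'a) \<Rightarrow> real \<Rightarrow> ('a \<Rightarrow> real \<Rightarrow> real) \<Rightarrow> ('a \<Rightarrow> complex) \<Rightarrow> (complex \<Rightarrow> 'a) \<Rightarrow>
     'a \<Rightarrow> real \<Rightarrow> real" where
  "Gproj S M f \<pi> \<sigma> \<theta> = G S M f \<theta> (\<sigma> (\<pi> \<theta>))"

definition Khat ::
    "('a \<Rightarrow> 'a) \<Rightarrow> real \<Rightarrow> ('a \<Rightarrow> real \<Rightarrow> real) \<Rightarrow> ('a \<Rightarrow> complex) \<Rightarrow> (complex \<Rightarrow> 'a) \<Rightarrow>
     'a \<Rightarrow> real set" where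
  "Khat S M f \<pi> \<sigma> \<theta> =
     {Gproj S M f \<pi> \<sigma> \<theta> (phi_minus S M f \<theta>)..Gproj S M f \<pi> \<sigma> \<theta> (phi_plus S M f \<theta>)}"

definition fhat ::
    "('a \<Rightarrow> 'a) \<Rightarrow> real \<Rightarrow> ('a \<Rightarrow> real \<Rightarrow> real) \<Rightarrow> ('a \<Rightarrow> complex) \<Rightarrow> (complex \<Rightarrow> 'a) \<Rightarrow>
     'a \<Rightarrow> real \<Rightarrow> real" where
  "fhat S M f \<pi> \<sigma> \<theta> =
     f (inv S (\<sigma> (\<pi> (S \<theta>)))) \<circ> G S M f (\<sigma> (\<pi> \<theta>)) (inv S (\<sigma> (\<pi> (S \<theta>))))"

end

theory Submission
  imports Defs
begin

text \<open>The holonomy \<open>G\<^bsub>\<theta>,\<theta>'\<^esub>\<close> is best understood through backward orbits. Every \<open>y \<in> K(\<theta>)\<close> has a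
  unique backward orbit \<open>y\<^sub>n \<in> [-M, M]\<close> over \<open>S\<^sup>-\<^sup>n\<theta>\<close>. If the base points \<open>\<theta>\<close>, \<open>\<theta>'\<close> approach each other
  like \<open>\<alpha>\<^sup>n\<close> in the past, then \<open>G\<^bsub>\<theta>,\<theta>'\<^esub>(y)\<close> exists and is the only point \<open>z \<in> K(\<theta>')\<close> whose
  backward orbit satisfies \<open>|z\<^sub>n - y\<^sub>n| = O(\<alpha>\<^sup>n)\<close> (\<open>G_past\<close>, \<open>G_unique\<close>). Both halves rest on
  \<open>\<alpha>\<Lambda> < 1\<close>, where \<open>\<Lambda>\<close> bounds the fibre derivatives: an error of size \<open>\<alpha>\<^sup>n\<close> committed
  \<open>n\<close> steps in the past is magnified to at most \<open>(\<alpha>\<Lambda>)\<^sup>n\<close> in the present.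

  Being asymptotic in the past is an equivalence relation preserved by \<open>S\<close>, and so is the
  shadowing relation between backward orbits. This gives at once the composition rule
  \<open>G\<^bsub>\<theta>',\<theta>''\<^esub> \<circ> G\<^bsub>\<theta>,\<theta>'\<^esub> = G\<^bsub>\<theta>,\<theta>''\<^esub>\<close> (\<open>G_comp\<close>), hence bijectivity, and the equivariance
  \<open>G\<^bsub>S\<theta>,S\<theta>'\<^esub> \<circ> f\<^sub>\<theta> = f\<^bsub>\<theta>'\<^esub> \<circ> G\<^bsub>\<theta>,\<theta>'\<^esub>\<close> (\<open>G_f\<close>), since applying \<open>f\<^sub>\<theta>\<close> only shifts a backward orbit.
  Write \<open>\<theta>\<^sub>0 = \<sigma>\<Pi>\<theta>\<close> and \<open>\<theta>\<^sub>1 = S\<^sup>-\<^sup>1\<sigma>\<Pi>S\<theta>\<close>. As \<open>\<Pi>\<theta>\<^sub>1 = \<Pi>\<theta>\<close>, the points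
  \<open>\<theta>\<close>, \<open>\<theta>\<^sub>0\<close>, \<open>\<theta>\<^sub>1\<close> are mutually asymptotic, and the conjugacy is
  \<open>f\<^bsub>\<theta>\<^sub>1\<^esub> \<circ> G\<^bsub>\<theta>\<^sub>0,\<theta>\<^sub>1\<^esub> \<circ> G\<^bsub>\<theta>,\<theta>\<^sub>0\<^esub> = f\<^bsub>\<theta>\<^sub>1\<^esub> \<circ> G\<^bsub>\<theta>,\<theta>\<^sub>1\<^esub> = G\<^bsub>S\<theta>,S\<theta>\<^sub>1\<^esub> \<circ> f\<^sub>\<theta>\<close>.
  Moreover \<open>\<Pi>\<theta>\<close> is the image of \<open>\<Pi>(S\<theta>)\<close> under the circle map, so \<open>\<theta>\<^sub>0\<close> and \<open>\<theta>\<^sub>1\<close>, and with them the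
  new fibre map, are functions of \<open>\<Pi>(S\<theta>)\<close>.

  For smoothness, the logarithmic derivative of the \<open>n\<close>-th approximation of \<open>G\<^bsub>\<theta>,\<theta>'\<^esub>\<close> is a sum
  of \<open>n\<close> differences of \<open>log f'\<close> along two backward orbit segments. Since \<open>log f'\<close> is Lipschitz in
  base and fibre, passing from \<open>n\<close> to \<open>n + 1\<close> changes it by \<open>O((n + 1)(\<alpha>\<Lambda>)\<^sup>n)\<close>, uniformly on
  \<open>K(\<theta>)\<close> (\<open>ln_DGn_step\<close>). Hence the derivatives converge uniformly to a continuous positive
  limit (\<open>G_deriv\<close>), and composing with \<open>f\<^bsub>\<theta>\<^sub>1\<^esub>\<close> gives a diffeomorphism (\<open>f_G_diffeo\<close>).\<close>

section \<open>Diffeomorphisms of compact intervals\<close>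

lemma continuous_on_inv_into_compact:
  fixes g :: "real \<Rightarrow> real"
  assumes "compact X" "inj_on g X" "continuous_on X g"
  shows "continuous_on (g ` X) (inv_into X g)"
  by (rule continuous_on_inv[OF assms(3,1)]) (simp add: assms(2))

text \<open>At an interior point this is the usual inverse function rule; the version relative to \<open>X\<close>
  also covers the one-sided derivatives at the endpoints of an interval.\<close>

lemma has_field_derivative_inv_into:
  fixes g :: "real \<Rightarrow> real"
  assumes X: "compact X" "inj_on g X" "continuous_on X g" and x: "x \<in> X"
    and der: "(g has_field_derivative D) (at x within X)" and "D \<noteq> 0"
  shows "(inv_into X g has_field_derivative inverse D) (at (g x) within g ` X)"
proof -
  let ?h = "inv_into X g"
  have hx: "?h (g x) = x"
    using X(2) x by simp
  have "continuous (at (g x) within g ` X) ?h"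
    using continuous_on_inv_into_compact[OF X] x
    by (simp add: continuous_on_eq_continuous_within)
  then have "(?h \<longlongrightarrow> x) (at (g x) within g ` X)"
    by (simp add: continuous_within hx)
  moreover have "\<forall>\<^sub>F v in at (g x) within g ` X. ?h v \<in> X \<and> ?h v \<noteq> x"
    unfolding eventually_at_filter
    by (rule always_eventually) (auto simp: inv_into_f_f[OF X(2)])
  ultimately have h: "filterlim ?h (at x within X) (at (g x) within g ` X)"
    by (simp add: filterlim_at)
  have "((\<lambda>u. inverse ((g u - g x) / (u - x))) \<longlongrightarrow> inverse D) (at x within X)"
    using der \<open>D \<noteq> 0\<close> by (intro tendsto_inverse) (simp_all add: has_field_derivative_iff)
  then have "((\<lambda>v. inverse ((g (?h v) - g x) / (?h v - x))) \<longlongrightarrow> inverse D)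
      (at (g x) within g ` X)"
    by (rule filterlim_compose[OF _ h])
  then have "((\<lambda>v. (?h v - ?h (g x)) / (v - g x)) \<longlongrightarrow> inverse D) (at (g x) within g ` X)"
    by (rule Lim_transform_eventually)
      (unfold eventually_at_filter, rule always_eventually, auto simp: hx f_inv_into_f)
  then show ?thesis
    by (simp add: has_field_derivative_iff)
qed

lemma deriv_on_eq:
  assumes "a < b" "x \<in> {a..b}" "(g has_field_derivative D) (at x within {a..b})"
  shows "deriv_on {a..b} g x = D"
  unfolding deriv_on_def using assms
  by (intro vector_derivative_within_closed_interval)
    (auto simp: has_real_derivative_iff_has_vector_derivative)

lemma Ck_on_1I:
  assumes "a < b" and der: "\<And>x. x \<in> {a..b} \<Longrightarrow> (g has_field_derivative D x) (at x within {a..b})"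
    and "continuous_on {a..b} D"
  shows "Ck_on 1 {a..b} g"
proof -
  have "continuous_on {a..b} (deriv_on {a..b} g) \<longleftrightarrow> continuous_on {a..b} D"
    by (rule continuous_on_cong[OF refl]) (rule deriv_on_eq[OF assms(1) _ der])
  moreover have "g differentiable_on {a..b}"
    unfolding differentiable_on_def
    using der real_differentiable_def by blast
  ultimately show ?thesis
    using assms by (simp add: Ck_on_def)
qed

lemma orientation_preserving_diffeo_onI:
  assumes ab: "a < b" and mono: "strict_mono_on {a..b} g" and im: "g ` {a..b} = {c..d}"
    and der: "\<And>x. x \<in> {a..b} \<Longrightarrow> (g has_field_derivative D x) (at x within {a..b})"
    and cont: "continuous_on {a..b} D" and pos: "\<And>x. x \<in> {a..b} \<Longrightarrow> 0 < D x"
  shows "orientation_preserving_diffeo_on {a..b} {c..d} g"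
proof -
  have inj: "inj_on g {a..b}"
    using mono by (rule strict_mono_on_imp_inj_on)
  have g: "continuous_on {a..b} g"
    using der by (rule DERIV_continuous_on)
  have cd: "c < d"
  proof -
    have "g a \<in> {c..d}" "g b \<in> {c..d}"
      unfolding im[symmetric] using ab by auto
    then show ?thesis
      using strict_mono_onD[OF mono, of a b] ab by auto
  qed
  have inv: "inv_into {a..b} g y \<in> {a..b}" "g (inv_into {a..b} g y) = y" if "y \<in> {c..d}" for y
    using that im inv_into_into[of y g "{a..b}"] f_inv_into_f[of y g "{a..b}"] by auto
  have cinv: "continuous_on {c..d} (inv_into {a..b} g)"
    using continuous_on_inv_into_compact[OF _ inj g] im by simp
  have "Ck_on 1 {c..d} (inv_into {a..b} g)"
  proof (rule Ck_on_1I[OF cd])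
    fix y assume y: "y \<in> {c..d}"
    let ?x = "inv_into {a..b} g y"
    have "D ?x \<noteq> 0"
      using pos[OF inv(1)[OF y]] by simp
    from has_field_derivative_inv_into[OF _ inj g inv(1)[OF y] der[OF inv(1)[OF y]] this]
    show "(inv_into {a..b} g has_field_derivative inverse (D ?x)) (at y within {c..d})"
      by (simp add: im inv(2)[OF y])
  next
    have "continuous_on {c..d} (\<lambda>y. D (inv_into {a..b} g y))"
      by (rule continuous_on_compose2[OF cont cinv]) (use inv in auto)
    then show "continuous_on {c..d} (\<lambda>y. inverse (D (inv_into {a..b} g y)))"
      by (rule continuous_on_inverse) (use inv pos in force)
  qed
  then show ?thesis
    unfolding orientation_preserving_diffeo_on_def diffeo_on_def bij_betw_def
    using inj im mono Ck_on_1I[OF ab der cont] by blast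
qed

section \<open>Backward orbits\<close>

text \<open>The quantitative content of the hypotheses: \<open>\<Lambda>\<close> is a Lipschitz constant of every fibre map,
  and \<open>log f'\<close> is jointly Lipschitz because \<open>f'\<close> is Lipschitz in the base and bounded away from
  zero while \<open>(log f')'\<close> is bounded. Requiring \<open>1 \<le> \<Lambda>\<close> costs nothing, as \<open>\<alpha> < 1\<close>, and lets one
  estimate \<open>\<alpha>\<close> by \<open>\<alpha>\<Lambda>\<close>.\<close>

locale fibre_system =
  fixes S :: "'a::metric_space \<Rightarrow> 'a" and M :: real and f Df :: "'a \<Rightarrow> real \<Rightarrow> real"
    and \<alpha> \<Lambda> L q :: real
  assumes bij_S: "bij S" and M_pos: "0 < M"
    and f_range: "f \<theta> ` {-M..M} \<subseteq> {-M..M}"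
    and f_mono: "strict_mono_on {-M..M} (f \<theta>)"
    and f_deriv: "y \<in> {-M..M} \<Longrightarrow> (f \<theta> has_field_derivative Df \<theta> y) (at y within {-M..M})"
    and Df_pos: "y \<in> {-M..M} \<Longrightarrow> 0 < Df \<theta> y" and Df_le: "y \<in> {-M..M} \<Longrightarrow> Df \<theta> y \<le> \<Lambda>"
    and f_lip: "y \<in> {-M..M} \<Longrightarrow> \<bar>f \<theta> y - f \<theta>' y\<bar> \<le> L * dist \<theta> \<theta>'"
    and ln_Df_lip: "y \<in> {-M..M} \<Longrightarrow> y' \<in> {-M..M} \<Longrightarrow>
      \<bar>ln (Df \<theta> y) - ln (Df \<theta>' y')\<bar> \<le> q * (dist \<theta> \<theta>' + \<bar>y - y'\<bar>)"
    and \<alpha>: "0 < \<alpha>" "\<alpha> < 1" and \<Lambda>: "1 \<le> \<Lambda>" "\<alpha> * \<Lambda> < 1" and Lq: "0 \<le> L" "0 \<le> q"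
begin

abbreviation I where "I \<equiv> {-M..M}"
abbreviation past where "past n \<equiv> inv S ^^ n"
abbreviation P where "P \<equiv> pullback_fibre_iter S f"
abbreviation lo where "lo \<equiv> phi_minus S M f"
abbreviation hi where "hi \<equiv> phi_plus S M f"
abbreviation Kf where "Kf \<equiv> K S M f"
abbreviation Gf where "Gf \<equiv> G S M f"

text \<open>For \<open>y \<in> K(\<theta>)\<close> the sequence \<open>n \<mapsto> pre n \<theta> y\<close> is the backward orbit of \<open>y\<close>.\<close>

definition pre :: "nat \<Rightarrow> 'a \<Rightarrow> real \<Rightarrow> real" where
  "pre n \<theta> = inv_into I (P n \<theta>)"

lemma S_inv [simp]: "S (inv S \<theta>) = \<theta>" and inv_S [simp]: "inv S (S \<theta>) = \<theta>"
  using bij_S by (simp_all add: bij_is_surj bij_is_inj surj_f_inv_f)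

lemma S_past [simp]: "(S ^^ n) (past n \<theta>) = \<theta>"
  by (induction n arbitrary: \<theta>) (simp_all add: funpow_swap1[of "inv S"])

lemma past_add: "past k (past n \<theta>) = past (k + n) \<theta>"
  by (simp add: funpow_add)

lemma P_0 [simp]: "P 0 \<theta> = id"
  by (simp add: pullback_fibre_iter_def)

lemma P_Suc: "P (Suc n) \<theta> = f (inv S \<theta>) \<circ> P n (inv S \<theta>)"
proof -
  have "past (Suc n) \<theta> = past n (inv S \<theta>)"
    by (simp add: funpow_swap1)
  then show ?thesis
    unfolding pullback_fibre_iter_def by (simp del: funpow.simps)
qed

lemma P_add: "P (n + k) \<theta> = P n \<theta> \<circ> P k (past n \<theta>)"
  by (induction n arbitrary: \<theta>) (simp_all add: P_Suc o_assoc funpow_swap1)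

lemma P_Suc_right: "P (Suc n) \<theta> = P n \<theta> \<circ> f (past (Suc n) \<theta>)"
  using P_add[of n 1 \<theta>] by (simp add: P_Suc)

lemma f_in: "y \<in> I \<Longrightarrow> f \<theta> y \<in> I"
  using f_range by blast

lemma P_in: "y \<in> I \<Longrightarrow> P n \<theta> y \<in> I"
proof (induction n arbitrary: \<theta>)
  case (Suc n)
  then show ?case using f_in by (auto simp: P_Suc simp del: atLeastAtMost_iff)
qed simp

lemma P_mono: "strict_mono_on I (P n \<theta>)"
proof (induction n arbitrary: \<theta>)
  case 0
  show ?case by (simp add: strict_mono_on_def)
next
  case (Suc n)
  show ?case
    unfolding P_Suc
    by (intro strict_mono_onI)
      (use strict_mono_onD[OF f_mono] strict_mono_onD[OF Suc] P_in in \<open>simp del: atLeastAtMost_iff\<close>)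
qed

lemma P_inj: "inj_on (P n \<theta>) I"
  using P_mono by (rule strict_mono_on_imp_inj_on)

lemma f_lip_fibre:
  assumes "y \<in> I" "z \<in> I"
  shows "\<bar>f \<theta> y - f \<theta> z\<bar> \<le> \<Lambda> * \<bar>y - z\<bar>"
  using field_differentiable_bound[of I "f \<theta>" "Df \<theta>" \<Lambda> y z] f_deriv Df_le Df_pos assms
  by (force simp: less_imp_le)

lemma P_lip:
  assumes "y \<in> I" "z \<in> I"
  shows "\<bar>P n \<theta> y - P n \<theta> z\<bar> \<le> \<Lambda> ^ n * \<bar>y - z\<bar>"
proof (induction n arbitrary: \<theta>)
  case (Suc n)
  have "\<bar>P (Suc n) \<theta> y - P (Suc n) \<theta> z\<bar> \<le> \<Lambda> * \<bar>P n (inv S \<theta>) y - P n (inv S \<theta>) z\<bar>"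
    using f_lip_fibre P_in assms by (simp add: P_Suc del: atLeastAtMost_iff)
  also have "\<dots> \<le> \<Lambda> * (\<Lambda> ^ n * \<bar>y - z\<bar>)"
    using Suc \<Lambda> by (intro mult_left_mono) auto
  finally show ?case by simp
qed simp

lemma P_continuous: "continuous_on I (P n \<theta>)"
  by (rule lipschitz_on_continuous_on[of "\<Lambda> ^ n"], rule lipschitz_onI)
    (use P_lip \<Lambda> in \<open>auto simp: dist_real_def simp del: atLeastAtMost_iff\<close>)

lemma P_image: "P n \<theta> ` I = {P n \<theta> (- M)..P n \<theta> M}"
proof
  have "mono_on I (P n \<theta>)"
    using P_mono by (rule strict_mono_on_imp_mono_on)
  then show "P n \<theta> ` I \<subseteq> {P n \<theta> (- M)..P n \<theta> M}"
    using M_pos by (auto intro!: mono_onD[of I "P n \<theta>"])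
  show "{P n \<theta> (- M)..P n \<theta> M} \<subseteq> P n \<theta> ` I"
    using IVT'[of "P n \<theta>" "- M" _ M] P_continuous M_pos by force
qed

lemma P_image_antimono: "P (n + k) \<theta> ` I \<subseteq> P n \<theta> ` I"
  using P_in by (auto simp: P_add simp del: atLeastAtMost_iff)

lemma bounding_graphs:
  shows lo_lim: "(\<lambda>n. P n \<theta> (- M)) \<longlonglongrightarrow> lo \<theta>" and lo_ge: "P n \<theta> (- M) \<le> lo \<theta>"
    and hi_lim: "(\<lambda>n. P n \<theta> M) \<longlonglongrightarrow> hi \<theta>" and hi_le: "hi \<theta> \<le> P n \<theta> M"
proof -
  have bounds: "P n \<theta> (- M) \<le> M" "- M \<le> P n \<theta> M" for n
    using P_in[of "- M" n \<theta>] P_in[of M n \<theta>] M_pos by auto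
  have ends: "P (Suc n) \<theta> (- M) \<in> P n \<theta> ` I" "P (Suc n) \<theta> M \<in> P n \<theta> ` I" for n
    using P_image_antimono[of n 1 \<theta>] M_pos by (auto simp: image_subset_iff)
  have "incseq (\<lambda>n. P n \<theta> (- M))" "decseq (\<lambda>n. P n \<theta> M)"
    using ends by (auto intro!: incseq_SucI decseq_SucI simp: P_image)
  then obtain l u where
    l: "(\<lambda>n. P n \<theta> (- M)) \<longlonglongrightarrow> l" "\<And>n. P n \<theta> (- M) \<le> l" and
    u: "(\<lambda>n. P n \<theta> M) \<longlonglongrightarrow> u" "\<And>n. u \<le> P n \<theta> M"
    using incseq_convergent[of "\<lambda>n. P n \<theta> (- M)" M] decseq_convergent[of "\<lambda>n. P n \<theta> M" "- M"] bounds
    by metis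
  moreover have "lo \<theta> = l" "hi \<theta> = u"
    using l u by (simp_all add: phi_minus_def phi_plus_def limI)
  ultimately show "(\<lambda>n. P n \<theta> (- M)) \<longlonglongrightarrow> lo \<theta>" "P n \<theta> (- M) \<le> lo \<theta>"
    "(\<lambda>n. P n \<theta> M) \<longlonglongrightarrow> hi \<theta>" "hi \<theta> \<le> P n \<theta> M"
    by simp_all
qed

lemma lo_le_hi: "lo \<theta> \<le> hi \<theta>"
  by (rule LIMSEQ_le[OF lo_lim hi_lim])
    (use strict_mono_onD[OF P_mono, of "- M" M] M_pos in \<open>auto intro: less_imp_le\<close>)

text \<open>The fibre \<open>K(\<theta>)\<close> consists of the points with arbitrarily long histories inside \<open>[-M, M]\<close>; by
  injectivity of the fibre maps these histories fit together to one backward orbit.\<close>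

lemma K_iff: "y \<in> Kf \<theta> \<longleftrightarrow> (\<forall>n. y \<in> P n \<theta> ` I)"
proof -
  have "y \<in> Kf \<theta> \<longleftrightarrow> (\<forall>n. P n \<theta> (- M) \<le> y \<and> y \<le> P n \<theta> M)"
    using lo_ge[of _ \<theta>] hi_le[of \<theta>] LIMSEQ_le_const2[OF lo_lim] LIMSEQ_le_const[OF hi_lim]
    unfolding K_def atLeastAtMost_iff by (meson order_trans)
  then show ?thesis
    by (simp add: P_image)
qed

lemma K_sub: "Kf \<theta> \<subseteq> I"
proof
  fix y assume "y \<in> Kf \<theta>"
  then have "y \<in> P 0 \<theta> ` I"
    unfolding K_iff by blast
  then show "y \<in> I" by simp
qed

lemma P_pre: "y \<in> Kf \<theta> \<Longrightarrow> P n \<theta> (pre n \<theta> y) = y"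
  and pre_in: "y \<in> Kf \<theta> \<Longrightarrow> pre n \<theta> y \<in> I"
  using K_iff[of y \<theta>] f_inv_into_f[of y "P n \<theta>" I] inv_into_into[of y "P n \<theta>" I]
  unfolding pre_def by blast+

lemma pre_eq: "x \<in> I \<Longrightarrow> P n \<theta> x = y \<Longrightarrow> pre n \<theta> y = x"
  unfolding pre_def using P_inj by (metis inv_into_f_f)

lemma pre_pre:
  assumes "y \<in> Kf \<theta>"
  shows "pre k (past n \<theta>) (pre n \<theta> y) = pre (n + k) \<theta> y"
    and "P k (past n \<theta>) (pre (n + k) \<theta> y) = pre n \<theta> y"
proof -
  have "P n \<theta> (P k (past n \<theta>) (pre (n + k) \<theta> y)) = y"
    using P_pre[OF assms, of "n + k"] by (simp add: P_add)
  then show *: "P k (past n \<theta>) (pre (n + k) \<theta> y) = pre n \<theta> y"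
    using pre_eq P_in pre_in[OF assms] by metis
  show "pre k (past n \<theta>) (pre n \<theta> y) = pre (n + k) \<theta> y"
    by (rule pre_eq[OF pre_in[OF assms] *])
qed

lemma pre_K:
  assumes "y \<in> Kf \<theta>"
  shows "pre n \<theta> y \<in> Kf (past n \<theta>)"
  unfolding K_iff using pre_pre(2)[OF assms] pre_in[OF assms] by (metis imageI)

lemma f_P: "f \<theta> (P n \<theta> x) = P (Suc n) (S \<theta>) x"
  by (simp add: P_Suc)

text \<open>Applying the fibre map extends a history by one step and otherwise shifts it.\<close>

lemma f_K: "y \<in> Kf \<theta> \<Longrightarrow> f \<theta> y \<in> Kf (S \<theta>)"
  and pre_f: "y \<in> Kf \<theta> \<Longrightarrow> pre (Suc n) (S \<theta>) (f \<theta> y) = pre n \<theta> y"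
proof -
  assume y: "y \<in> Kf \<theta>"
  have *: "P (Suc n) (S \<theta>) (pre n \<theta> y) = f \<theta> y" for n
    using f_P[of \<theta> n "pre n \<theta> y"] P_pre[OF y, of n] by simp
  show "pre (Suc n) (S \<theta>) (f \<theta> y) = pre n \<theta> y"
    by (rule pre_eq[OF pre_in[OF y] *])
  have "f \<theta> y \<in> P (Suc n) (S \<theta>) ` I" for n
    using * pre_in[OF y] by (metis imageI)
  then show "f \<theta> y \<in> Kf (S \<theta>)"
    unfolding K_iff using P_image_antimono[of _ 1] by force
qed

lemma f_K_image: "f \<theta> ` Kf \<theta> = Kf (S \<theta>)"
proof
  show "f \<theta> ` Kf \<theta> \<subseteq> Kf (S \<theta>)"
    using f_K by blast
  show "Kf (S \<theta>) \<subseteq> f \<theta> ` Kf \<theta>"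
  proof
    fix z assume z: "z \<in> Kf (S \<theta>)"
    have "pre 1 (S \<theta>) z \<in> Kf \<theta>" "f \<theta> (pre 1 (S \<theta>) z) = z"
      using pre_K[OF z, of 1] P_pre[OF z, of 1] by (simp_all add: P_Suc)
    then show "z \<in> f \<theta> ` Kf \<theta>"
      by force
  qed
qed

section \<open>The holonomy maps\<close>

text \<open>Unlike membership in a local stable fibre, whose constants are prescribed, this relation with
  unspecified \<open>c\<close> is symmetric, transitive and invariant under \<open>S\<close>. It includes \<open>n = 0\<close>, so that
  \<open>c\<close> also bounds the present distance.\<close>

definition asymptotic :: "real \<Rightarrow> 'a \<Rightarrow> 'a \<Rightarrow> bool" where
  "asymptotic c \<theta> \<theta>' \<longleftrightarrow> 0 \<le> c \<and> (\<forall>n. dist (past n \<theta>) (past n \<theta>') \<le> c * \<alpha> ^ n)"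

lemma asymptotic_sym: "asymptotic c \<theta> \<theta>' \<Longrightarrow> asymptotic c \<theta>' \<theta>"
  by (simp add: asymptotic_def dist_commute)

lemma asymptotic_refl: "asymptotic 0 \<theta> \<theta>"
  by (simp add: asymptotic_def)

lemma asymptotic_trans:
  assumes "asymptotic c \<theta> \<theta>'" "asymptotic d \<theta>' \<theta>''"
  shows "asymptotic (c + d) \<theta> \<theta>''"
  unfolding asymptotic_def
proof (intro conjI allI)
  show "0 \<le> c + d" using assms by (simp add: asymptotic_def)
  fix n
  have "dist (past n \<theta>) (past n \<theta>'') \<le> dist (past n \<theta>) (past n \<theta>') + dist (past n \<theta>') (past n \<theta>'')"
    by (rule dist_triangle)
  also have "\<dots> \<le> c * \<alpha> ^ n + d * \<alpha> ^ n"
    using assms by (intro add_mono) (simp_all add: asymptotic_def)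
  finally show "dist (past n \<theta>) (past n \<theta>'') \<le> (c + d) * \<alpha> ^ n"
    by (simp add: algebra_simps)
qed

lemma asymptotic_past:
  assumes "asymptotic c \<theta> \<theta>'"
  shows "asymptotic (c * \<alpha> ^ k) (past k \<theta>) (past k \<theta>')"
  using assms \<alpha> unfolding asymptotic_def past_add
  by (simp add: power_add mult_ac) (metis add.commute power_add)

lemma asymptotic_S:
  assumes "asymptotic c \<theta> \<theta>'"
  shows "asymptotic (c / \<alpha> + dist (S \<theta>) (S \<theta>')) (S \<theta>) (S \<theta>')"
  unfolding asymptotic_def
proof (intro conjI allI)
  show "0 \<le> c / \<alpha> + dist (S \<theta>) (S \<theta>')"
    using assms \<alpha> by (simp add: asymptotic_def)
  fix n
  show "dist (past n (S \<theta>)) (past n (S \<theta>')) \<le> (c / \<alpha> + dist (S \<theta>) (S \<theta>')) * \<alpha> ^ n"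
  proof (cases n)
    case 0
    then show ?thesis using assms \<alpha> by (simp add: asymptotic_def)
  next
    case (Suc k)
    have "dist (past n (S \<theta>)) (past n (S \<theta>')) \<le> c * \<alpha> ^ k"
      using assms by (simp add: Suc funpow_swap1 asymptotic_def)
    also have "\<dots> = c / \<alpha> * \<alpha> ^ n"
      using \<alpha> by (simp add: Suc)
    also have "\<dots> \<le> (c / \<alpha> + dist (S \<theta>) (S \<theta>')) * \<alpha> ^ n"
      using \<alpha> by (intro mult_right_mono) auto
    finally show ?thesis .
  qed
qed

lemma Gn_eq: "Gn S M f \<theta> \<theta>' n y = P n \<theta>' (pre n \<theta> y)"
  by (simp add: Gn_def pre_def)

text \<open>The approximations over \<open>\<theta>\<close> are images of those over \<open>S\<^sup>-\<^sup>k\<theta>\<close>, which allows an estimate for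
  \<open>\<theta>\<close>, \<open>\<theta>'\<close> to be transported to all the past pairs, where the constant is smaller by \<open>\<alpha>\<^sup>k\<close>.\<close>

lemma Gn_add:
  assumes "y \<in> Kf \<theta>"
  shows "Gn S M f \<theta> \<theta>' (k + j) y
    = P k \<theta>' (Gn S M f (past k \<theta>) (past k \<theta>') j (pre k \<theta> y))"
  using pre_pre(1)[OF assms, of j k] by (simp add: Gn_eq P_add)

lemma Gn_in: "y \<in> Kf \<theta> \<Longrightarrow> Gn S M f \<theta> \<theta>' n y \<in> I"
  by (simp add: Gn_eq P_in pre_in del: atLeastAtMost_iff)

text \<open>Two consecutive approximations differ only in the fibre map applied at the first step, over
  \<open>S\<^sup>-\<^sup>n\<^sup>-\<^sup>1\<theta>\<close> or over \<open>S\<^sup>-\<^sup>n\<^sup>-\<^sup>1\<theta>'\<close>; that error of order \<open>\<alpha>\<^sup>n\<close> is then stretched by at most \<open>\<Lambda>\<^sup>n\<close>.\<close>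

lemma Gn_step:
  assumes a: "asymptotic c \<theta> \<theta>'" and y: "y \<in> Kf \<theta>"
  shows "\<bar>Gn S M f \<theta> \<theta>' (Suc n) y - Gn S M f \<theta> \<theta>' n y\<bar> \<le> L * c * (\<alpha> * \<Lambda>) ^ n"
proof -
  let ?x = "pre (Suc n) \<theta> y"
  let ?u = "past (Suc n) \<theta>" and ?u' = "past (Suc n) \<theta>'"
  have x: "?x \<in> I" using pre_in[OF y] .
  have "pre n \<theta> y = f ?u ?x"
    using pre_pre(2)[OF y, of 1 n] by (simp add: P_Suc)
  then have "\<bar>Gn S M f \<theta> \<theta>' (Suc n) y - Gn S M f \<theta> \<theta>' n y\<bar> = \<bar>P n \<theta>' (f ?u' ?x) - P n \<theta>' (f ?u ?x)\<bar>"
    by (simp add: Gn_eq P_Suc_right)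
  also have "\<dots> \<le> \<Lambda> ^ n * \<bar>f ?u' ?x - f ?u ?x\<bar>"
    by (intro P_lip f_in x)
  also have "\<dots> \<le> \<Lambda> ^ n * (L * (c * \<alpha> ^ n))"
  proof (rule mult_left_mono)
    have "\<bar>f ?u' ?x - f ?u ?x\<bar> \<le> L * dist ?u' ?u"
      by (rule f_lip[OF x])
    also have "\<dots> \<le> L * (c * \<alpha> ^ Suc n)"
      using a Lq unfolding asymptotic_def by (metis dist_commute mult_left_mono)
    also have "\<dots> \<le> L * (c * \<alpha> ^ n)"
      using a \<alpha> Lq by (intro mult_left_mono power_decreasing) (auto simp: asymptotic_def)
    finally show "\<bar>f ?u' ?x - f ?u ?x\<bar> \<le> L * (c * \<alpha> ^ n)" .
  qed (use \<Lambda> in simp)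
  finally show ?thesis
    by (simp add: power_mult_distrib mult_ac)
qed

lemma Gn_limit:
  assumes a: "asymptotic c \<theta> \<theta>'" and y: "y \<in> Kf \<theta>"
  shows "(\<lambda>n. Gn S M f \<theta> \<theta>' n y) \<longlonglongrightarrow> Gf \<theta> \<theta>' y"
    and "\<bar>Gf \<theta> \<theta>' y - y\<bar> \<le> L * c / (1 - \<alpha> * \<Lambda>)"
proof -
  let ?g = "\<lambda>n. Gn S M f \<theta> \<theta>' n y"
  let ?d = "\<lambda>n. ?g (Suc n) - ?g n"
  have g0: "?g 0 = y"
    using P_pre[OF y, of 0] by (simp add: Gn_eq)
  have geo: "(\<lambda>n. L * c * (\<alpha> * \<Lambda>) ^ n) sums (L * c * (1 / (1 - \<alpha> * \<Lambda>)))"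
    using \<alpha> \<Lambda> by (intro sums_mult geometric_sums) simp
  have d: "norm (?d n) \<le> L * c * (\<alpha> * \<Lambda>) ^ n" for n
    using Gn_step[OF assms] by simp
  have "summable ?d"
    by (rule summable_comparison_test'[OF sums_summable[OF geo]]) (use d in simp)
  then have "(\<lambda>n. ?g n - y) \<longlonglongrightarrow> suminf ?d"
    using summable_LIMSEQ[of ?d] by (simp add: sum_lessThan_telescope[of ?g] g0)
  from tendsto_add[OF this tendsto_const[of y]]
  have lim: "?g \<longlonglongrightarrow> suminf ?d + y"
    by simp
  then show "?g \<longlonglongrightarrow> Gf \<theta> \<theta>' y"
    unfolding G_def by (simp add: limI)
  moreover have "\<bar>suminf ?d\<bar> \<le> L * c * (1 / (1 - \<alpha> * \<Lambda>))"
    using norm_suminf_le[OF d sums_summable[OF geo]] sums_unique[OF geo] by simp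
  ultimately show "\<bar>Gf \<theta> \<theta>' y - y\<bar> \<le> L * c / (1 - \<alpha> * \<Lambda>)"
    using LIMSEQ_unique[OF lim] by force
qed

text \<open>The backward orbit of \<open>G\<^bsub>\<theta>,\<theta>'\<^esub>(y)\<close> is obtained by applying the holonomies in the past to the
  backward orbit of \<open>y\<close>. Those are within \<open>O(\<alpha>\<^sup>k)\<close> of the identity, so the two orbits
  shadow each other.\<close>

lemma G_past:
  assumes a: "asymptotic c \<theta> \<theta>'" and y: "y \<in> Kf \<theta>"
  defines "z k \<equiv> Gf (past k \<theta>) (past k \<theta>') (pre k \<theta> y)"
  shows "z k \<in> I" "P k \<theta>' (z k) = Gf \<theta> \<theta>' y" "Gf \<theta> \<theta>' y \<in> Kf \<theta>'"
    "pre k \<theta>' (Gf \<theta> \<theta>' y) = z k" 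
    "\<bar>pre k \<theta>' (Gf \<theta> \<theta>' y) - pre k \<theta> y\<bar> \<le> L * c / (1 - \<alpha> * \<Lambda>) * \<alpha> ^ k"
proof -
  have lim: "(\<lambda>j. Gn S M f (past k \<theta>) (past k \<theta>') j (pre k \<theta> y)) \<longlonglongrightarrow> z k" for k
    unfolding z_def by (rule Gn_limit(1)[OF asymptotic_past[OF a] pre_K[OF y]])
  have zI: "z k \<in> I" for k
    by (rule closed_sequentially[OF closed_real_atLeastAtMost _ lim])
      (rule Gn_in[OF pre_K[OF y]])
  show "z k \<in> I" by (rule zI)
  have Pz: "P k \<theta>' (z k) = Gf \<theta> \<theta>' y" for k
  proof (rule LIMSEQ_unique)
    show "(\<lambda>j. P k \<theta>' (Gn S M f (past k \<theta>) (past k \<theta>') j (pre k \<theta> y))) \<longlonglongrightarrow> P k \<theta>' (z k)"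
      by (rule continuous_on_tendsto_compose[OF P_continuous lim zI])
        (rule always_eventually allI Gn_in pre_K y)+
    show "(\<lambda>j. P k \<theta>' (Gn S M f (past k \<theta>) (past k \<theta>') j (pre k \<theta> y))) \<longlonglongrightarrow> Gf \<theta> \<theta>' y"
      using LIMSEQ_ignore_initial_segment[OF Gn_limit(1)[OF a y], of k]
      by (simp add: Gn_add[OF y] add.commute[of _ k])
  qed
  then show "P k \<theta>' (z k) = Gf \<theta> \<theta>' y" .
  show "Gf \<theta> \<theta>' y \<in> Kf \<theta>'"
    unfolding K_iff using Pz zI by (metis imageI)
  show b: "pre k \<theta>' (Gf \<theta> \<theta>' y) = z k"
    by (rule pre_eq[OF zI Pz])
  show "\<bar>pre k \<theta>' (Gf \<theta> \<theta>' y) - pre k \<theta> y\<bar> \<le> L * c / (1 - \<alpha> * \<Lambda>) * \<alpha> ^ k"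
    unfolding b unfolding z_def
    using Gn_limit(2)[OF asymptotic_past[OF a] pre_K[OF y], of k] by (simp add: mult_ac)
qed

text \<open>Two points over \<open>\<theta>'\<close> whose backward orbits are \<open>O(\<alpha>\<^sup>n)\<close> apart coincide, because \<open>n\<close> steps
  forward stretch distances by at most \<open>\<Lambda>\<^sup>n\<close>. Identities between holonomy maps thereby reduce to
  comparing backward orbits. The offset \<open>k\<close> makes it possible to ignore finitely many terms, such
  as the first one after an application of \<open>S\<close>.\<close>

lemma G_unique:
  assumes a: "asymptotic c \<theta> \<theta>'" and y: "y \<in> Kf \<theta>" and z: "z \<in> Kf \<theta>'"
    and close: "\<And>n. \<bar>pre (n + k) \<theta>' z - pre (n + k) \<theta> y\<bar> \<le> B * \<alpha> ^ n"
  shows "Gf \<theta> \<theta>' y = z"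
proof -
  let ?w = "Gf \<theta> \<theta>' y"
  have w: "?w \<in> Kf \<theta>'"
    by (rule G_past(3)[OF a y])
  define E where "E = L * c / (1 - \<alpha> * \<Lambda>) * \<alpha> ^ k + B"
  have "\<bar>?w - z\<bar> \<le> E * \<Lambda> ^ k * (\<alpha> * \<Lambda>) ^ n" for n
  proof -
    have "\<bar>?w - z\<bar> = \<bar>P (n + k) \<theta>' (pre (n + k) \<theta>' ?w) - P (n + k) \<theta>' (pre (n + k) \<theta>' z)\<bar>"
      by (simp add: P_pre w z)
    also have "\<dots> \<le> \<Lambda> ^ (n + k) * \<bar>pre (n + k) \<theta>' ?w - pre (n + k) \<theta>' z\<bar>"
      by (intro P_lip pre_in w z)
    also have "\<dots> \<le> \<Lambda> ^ (n + k) * (E * \<alpha> ^ n)"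
    proof (rule mult_left_mono)
      show "\<bar>pre (n + k) \<theta>' ?w - pre (n + k) \<theta>' z\<bar> \<le> E * \<alpha> ^ n"
        using G_past(5)[OF a y, of "n + k"] close[of n]
        by (simp add: E_def algebra_simps power_add)
    qed (use \<Lambda> in simp)
    finally show ?thesis
      by (simp add: power_mult_distrib power_add mult_ac)
  qed
  moreover have "(\<lambda>n. E * \<Lambda> ^ k * (\<alpha> * \<Lambda>) ^ n) \<longlonglongrightarrow> E * \<Lambda> ^ k * 0"
    using \<alpha> \<Lambda> by (intro tendsto_mult tendsto_const LIMSEQ_realpow_zero) auto
  ultimately have "\<bar>?w - z\<bar> \<le> 0"
    by (intro LIMSEQ_le_const) auto
  then show ?thesis by simp
qed

lemma G_comp:
  assumes a: "asymptotic c \<theta> \<theta>'" and b: "asymptotic d \<theta>' \<theta>''" and y: "y \<in> Kf \<theta>"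
  shows "Gf \<theta>' \<theta>'' (Gf \<theta> \<theta>' y) = Gf \<theta> \<theta>'' y"
proof (rule sym, rule G_unique[OF asymptotic_trans[OF a b] y, where k = 0])
  let ?w = "Gf \<theta> \<theta>' y"
  have w: "?w \<in> Kf \<theta>'"
    by (rule G_past(3)[OF a y])
  show "Gf \<theta>' \<theta>'' ?w \<in> Kf \<theta>''"
    by (rule G_past(3)[OF b w])
  show "\<bar>pre (n + 0) \<theta>'' (Gf \<theta>' \<theta>'' ?w) - pre (n + 0) \<theta> y\<bar>
      \<le> (L * c / (1 - \<alpha> * \<Lambda>) + L * d / (1 - \<alpha> * \<Lambda>)) * \<alpha> ^ n" for n
    using G_past(5)[OF a y, of n] G_past(5)[OF b w, of n] by (simp add: algebra_simps)
qed

lemma G_refl: "y \<in> Kf \<theta> \<Longrightarrow> Gf \<theta> \<theta> y = y"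
  by (rule G_unique[OF asymptotic_refl, where k = 0 and B = 0]) simp_all

lemma G_inverse:
  assumes a: "asymptotic c \<theta> \<theta>'" and y: "y \<in> Kf \<theta>"
  shows "Gf \<theta>' \<theta> (Gf \<theta> \<theta>' y) = y"
  using G_comp[OF a asymptotic_sym[OF a] y] G_refl[OF y] by simp

lemma G_f:
  assumes a: "asymptotic c \<theta> \<theta>'" and y: "y \<in> Kf \<theta>"
  shows "Gf (S \<theta>) (S \<theta>') (f \<theta> y) = f \<theta>' (Gf \<theta> \<theta>' y)"
proof (rule G_unique[OF asymptotic_S[OF a] f_K[OF y] f_K[OF G_past(3)[OF a y]], where k = 1])
  show "\<bar>pre (n + 1) (S \<theta>') (f \<theta>' (Gf \<theta> \<theta>' y)) - pre (n + 1) (S \<theta>) (f \<theta> y)\<bar>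
      \<le> L * c / (1 - \<alpha> * \<Lambda>) * \<alpha> ^ n" for n
    using G_past(5)[OF a y, of n] by (simp add: pre_f[OF y] pre_f[OF G_past(3)[OF a y]])
qed

lemma G_bij:
  assumes a: "asymptotic c \<theta> \<theta>'"
  shows "bij_betw (Gf \<theta> \<theta>') (Kf \<theta>) (Kf \<theta>')"
  by (rule bij_betwI[where g = "Gf \<theta>' \<theta>"])
    (use G_past(3)[OF a] G_past(3)[OF asymptotic_sym[OF a]] G_inverse[OF a]
      G_inverse[OF asymptotic_sym[OF a]] in auto)

lemma pre_mono:
  assumes "y \<in> Kf \<theta>" "z \<in> Kf \<theta>" "y \<le> z"
  shows "pre n \<theta> y \<le> pre n \<theta> z"
  using strict_mono_onD[OF P_mono pre_in[OF assms(2)] pre_in[OF assms(1)], of n n n \<theta>]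
    P_pre[OF assms(1), of n] P_pre[OF assms(2), of n] assms(3)
  by (cases "pre n \<theta> z < pre n \<theta> y") simp_all

lemma G_mono:
  assumes a: "asymptotic c \<theta> \<theta>'"
  shows "strict_mono_on (Kf \<theta>) (Gf \<theta> \<theta>')"
proof (rule strict_mono_onI)
  fix y z assume y: "y \<in> Kf \<theta>" and z: "z \<in> Kf \<theta>" and "y < z"
  have "Gn S M f \<theta> \<theta>' n y \<le> Gn S M f \<theta> \<theta>' n z" for n
    unfolding Gn_eq
    by (rule mono_onD[OF strict_mono_on_imp_mono_on[OF P_mono]])
      (use pre_in y z pre_mono \<open>y < z\<close> in \<open>auto simp del: atLeastAtMost_iff\<close>)
  then have "Gf \<theta> \<theta>' y \<le> Gf \<theta> \<theta>' z"
    by (intro LIMSEQ_le[OF Gn_limit(1)[OF a y] Gn_limit(1)[OF a z]]) auto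
  moreover have "Gf \<theta> \<theta>' y \<noteq> Gf \<theta> \<theta>' z"
    using bij_betw_imp_inj_on[OF G_bij[OF a]] y z \<open>y < z\<close> by (auto dest: inj_onD)
  ultimately show "Gf \<theta> \<theta>' y < Gf \<theta> \<theta>' z"
    by simp
qed

text \<open>An increasing bijection between closed intervals maps endpoints to endpoints.\<close>

lemma G_ends:
  assumes a: "asymptotic c \<theta> \<theta>'"
  shows "Gf \<theta> \<theta>' (lo \<theta>) = lo \<theta>'" "Gf \<theta> \<theta>' (hi \<theta>) = hi \<theta>'"
proof -
  have im: "Gf \<theta> \<theta>' ` Kf \<theta> = Kf \<theta>'"
    using G_bij[OF a] by (rule bij_betw_imp_surj_on)
  have ends: "lo \<theta> \<in> Kf \<theta>" "hi \<theta> \<in> Kf \<theta>" "lo \<theta>' \<in> Kf \<theta>'" "hi \<theta>' \<in> Kf \<theta>'"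
    using lo_le_hi by (simp_all add: K_def)
  have mono: "mono_on (Kf \<theta>) (Gf \<theta> \<theta>')"
    using G_mono[OF a] by (rule strict_mono_on_imp_mono_on)
  have bounds: "Gf \<theta> \<theta>' (lo \<theta>) \<le> z \<and> z \<le> Gf \<theta> \<theta>' (hi \<theta>)" if "z \<in> Kf \<theta>'" for z
  proof -
    obtain y where "y \<in> Kf \<theta>" "z = Gf \<theta> \<theta>' y"
      using \<open>z \<in> Kf \<theta>'\<close> im by blast
    then show ?thesis
      using mono_onD[OF mono ends(1), of y] mono_onD[OF mono _ ends(2), of y] by (simp add: K_def)
  qed
  have "Gf \<theta> \<theta>' (lo \<theta>) \<in> Kf \<theta>'" "Gf \<theta> \<theta>' (hi \<theta>) \<in> Kf \<theta>'"
    using im ends by blast+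
  then show "Gf \<theta> \<theta>' (lo \<theta>) = lo \<theta>'" "Gf \<theta> \<theta>' (hi \<theta>) = hi \<theta>'"
    using bounds[OF ends(3)] bounds[OF ends(4)] by (simp_all add: K_def)
qed

section \<open>Differentiability of the holonomy maps\<close>

lemma ln_Df_continuous: "continuous_on I (\<lambda>y. ln (Df \<theta> y))"
  by (rule lipschitz_on_continuous_on[of q], rule lipschitz_onI)
    (use ln_Df_lip[of _ _ \<theta> \<theta>] Lq in \<open>auto simp: dist_real_def simp del: atLeastAtMost_iff\<close>)

lemma Df_continuous: "continuous_on I (Df \<theta>)"
proof -
  have "continuous_on I (\<lambda>y. exp (ln (Df \<theta> y)))"
    by (intro continuous_on_exp ln_Df_continuous)
  then show ?thesis
    by (rule continuous_on_eq) (simp add: Df_pos)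
qed

definition ln_DP :: "nat \<Rightarrow> 'a \<Rightarrow> real \<Rightarrow> real" where
  "ln_DP n \<theta> x = (\<Sum>k<n. ln (Df (past (Suc k) \<theta>) (P (n - Suc k) (past (Suc k) \<theta>) x)))"

lemma ln_DP_Suc: "ln_DP (Suc n) \<theta> x = ln (Df (inv S \<theta>) (P n (inv S \<theta>) x)) + ln_DP n (inv S \<theta>) x"
  unfolding ln_DP_def sum.lessThan_Suc_shift
  by (simp add: funpow_swap1)

lemma P_deriv:
  assumes "x \<in> I"
  shows "(P n \<theta> has_field_derivative exp (ln_DP n \<theta> x)) (at x within I)"
proof (induction n arbitrary: \<theta>)
  case 0
  show ?case by (simp add: ln_DP_def id_def)
next
  case (Suc n)
  let ?p = "P n (inv S \<theta>)"
  have "(f (inv S \<theta>) has_field_derivative Df (inv S \<theta>) (?p x)) (at (?p x) within ?p ` I)"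
    by (rule has_field_derivative_subset[OF f_deriv]) (use P_in assms in blast)+
  from DERIV_image_chain[OF this Suc]
  show ?case
    using Df_pos[OF P_in[OF assms], of "inv S \<theta>" n "inv S \<theta>"]
    by (simp add: P_Suc ln_DP_Suc exp_add del: o_apply comp_apply)
qed

lemma ln_DP_continuous: "continuous_on I (ln_DP n \<theta>)"
  unfolding ln_DP_def
  by (intro continuous_on_sum continuous_on_compose2[OF ln_Df_continuous P_continuous])
    (use P_in in blast)

lemma pre_image: "y \<in> Kf \<theta> \<Longrightarrow> y \<in> P n \<theta> ` I"
  using K_iff by blast

lemma pre_continuous: "continuous_on (Kf \<theta>) (pre n \<theta>)"
  unfolding pre_def
  by (rule continuous_on_subset[OF continuous_on_inv_into_compact[OF _ P_inj P_continuous]])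
    (use pre_image in auto)

lemma pre_deriv:
  assumes y: "y \<in> Kf \<theta>"
  shows "(pre n \<theta> has_field_derivative exp (- ln_DP n \<theta> (pre n \<theta> y))) (at y within Kf \<theta>)"
proof -
  have "(pre n \<theta> has_field_derivative inverse (exp (ln_DP n \<theta> (pre n \<theta> y))))
      (at (P n \<theta> (pre n \<theta> y)) within P n \<theta> ` I)"
    unfolding pre_def
    by (rule has_field_derivative_inv_into[OF _ P_inj P_continuous _ P_deriv])
      (use pre_in[OF y, of n] in \<open>simp_all add: pre_def\<close>)
  then show ?thesis
    unfolding P_pre[OF y] exp_minus
    by (rule has_field_derivative_subset) (use pre_image in auto)
qed

definition ln_DGn :: "'a \<Rightarrow> 'a \<Rightarrow> nat \<Rightarrow> real \<Rightarrow> real" where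
  "ln_DGn \<theta> \<theta>' n y = ln_DP n \<theta>' (pre n \<theta> y) - ln_DP n \<theta> (pre n \<theta> y)"

lemma Gn_deriv:
  assumes y: "y \<in> Kf \<theta>"
  shows "(Gn S M f \<theta> \<theta>' n has_field_derivative exp (ln_DGn \<theta> \<theta>' n y)) (at y within Kf \<theta>)"
proof -
  have "(P n \<theta>' has_field_derivative exp (ln_DP n \<theta>' (pre n \<theta> y)))
      (at (pre n \<theta> y) within pre n \<theta> ` Kf \<theta>)"
    by (rule has_field_derivative_subset[OF P_deriv[OF pre_in[OF y]]]) (use pre_in in blast)
  from DERIV_image_chain[OF this pre_deriv[OF y]]
  show ?thesis
    by (simp add: Gn_def pre_def[symmetric] ln_DGn_def exp_add[symmetric])
qed

lemma ln_DGn_continuous: "continuous_on (Kf \<theta>) (ln_DGn \<theta> \<theta>' n)"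
  unfolding ln_DGn_def
  by (intro continuous_on_diff continuous_on_compose2[OF ln_DP_continuous pre_continuous])
    (use pre_in in blast)+

text \<open>Along the orbit segment over \<open>\<theta>\<close> the chain rule visits the points \<open>pre (k + 1) \<theta> y\<close>; over
  \<open>\<theta>'\<close> it visits approximate holonomy images of these same points.\<close>

lemma ln_DGn_eq:
  assumes y: "y \<in> Kf \<theta>"
  shows "ln_DGn \<theta> \<theta>' n y = (\<Sum>k<n.
    ln (Df (past (Suc k) \<theta>') (Gn S M f (past (Suc k) \<theta>) (past (Suc k) \<theta>') (n - Suc k) (pre (Suc k) \<theta> y)))
    - ln (Df (past (Suc k) \<theta>) (pre (Suc k) \<theta> y)))"
proof -
  have *: "pre (n - Suc k) (past (Suc k) \<theta>) (pre (Suc k) \<theta> y) = pre n \<theta> y"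
      "P (n - Suc k) (past (Suc k) \<theta>) (pre n \<theta> y) = pre (Suc k) \<theta> y" if "k < n" for k
    using pre_pre[OF y, of "n - Suc k" "Suc k"] that by (simp_all del: funpow.simps)
  show ?thesis
    unfolding ln_DGn_def ln_DP_def sum_subtractf[symmetric]
    by (rule sum.cong) (simp_all add: Gn_eq * del: funpow.simps)
qed

text \<open>Each of the \<open>n\<close> old summands moves because its point over \<open>\<theta>'\<close> moves, by at most
  \<open>O(\<alpha>\<^sup>k\<^sup>+\<^sup>1 (\<alpha>\<Lambda>)\<^sup>n\<^sup>-\<^sup>k\<^sup>-\<^sup>1)\<close> according to \<open>Gn_step\<close>; the one new summand is of the order of the distance
  of the base points at time \<open>-n - 1\<close>. All of them are \<open>O((\<alpha>\<Lambda>)\<^sup>n)\<close>.\<close>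

lemma ln_DGn_step:
  assumes a: "asymptotic c \<theta> \<theta>'" and y: "y \<in> Kf \<theta>"
  shows "\<bar>ln_DGn \<theta> \<theta>' (Suc n) y - ln_DGn \<theta> \<theta>' n y\<bar> \<le> q * c * (L + 1) * (real (Suc n) * (\<alpha> * \<Lambda>) ^ n)"
proof -
  define g where "g k j = Gn S M f (past k \<theta>) (past k \<theta>') j (pre k \<theta> y)" for k j
  let ?b = "q * c * (L + 1) * (\<alpha> * \<Lambda>) ^ n"
  let ?t = "\<lambda>k. ln (Df (past (Suc k) \<theta>') (g (Suc k) (Suc n - Suc k)))
    - ln (Df (past (Suc k) \<theta>') (g (Suc k) (n - Suc k)))"
  let ?r = "ln (Df (past (Suc n) \<theta>') (g (Suc n) 0)) - ln (Df (past (Suc n) \<theta>) (pre (Suc n) \<theta> y))"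
  have c: "0 \<le> c"
    using a by (simp add: asymptotic_def)
  have gI: "g k j \<in> I" for k j
    unfolding g_def by (rule Gn_in[OF pre_K[OF y]])
  have "ln_DGn \<theta> \<theta>' (Suc n) y - ln_DGn \<theta> \<theta>' n y = (\<Sum>k<n. ?t k) + ?r"
    unfolding ln_DGn_eq[OF y] g_def[symmetric]
    by (simp add: sum_subtractf[symmetric] algebra_simps del: funpow.simps)
  also have "\<bar>\<dots>\<bar> \<le> (\<Sum>k<n. ?b) + ?b"
  proof (rule order_trans[OF abs_triangle_ineq], rule add_mono)
    show "\<bar>\<Sum>k<n. ?t k\<bar> \<le> (\<Sum>k<n. ?b)"
    proof (rule order_trans[OF sum_abs], rule sum_mono)
      fix k assume "k \<in> {..<n}"
      then have k: "Suc n - Suc k = Suc (n - Suc k)" and kn: "Suc k + (n - Suc k) = n" by auto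
      have "\<bar>?t k\<bar> \<le> q * \<bar>g (Suc k) (Suc (n - Suc k)) - g (Suc k) (n - Suc k)\<bar>"
        using ln_Df_lip[OF gI gI, of "past (Suc k) \<theta>'" "Suc k" _ "past (Suc k) \<theta>'" "Suc k"]
        by (simp only: k dist_self add_0)
      also have "\<dots> \<le> q * (L * (c * \<alpha> ^ Suc k) * (\<alpha> * \<Lambda>) ^ (n - Suc k))"
        unfolding g_def using Lq by (intro mult_left_mono Gn_step asymptotic_past a pre_K y)
      also have "\<dots> \<le> q * (L * (c * (\<alpha> * \<Lambda>) ^ Suc k) * (\<alpha> * \<Lambda>) ^ (n - Suc k))"
        using Lq c \<alpha> \<Lambda> by (intro mult_left_mono mult_right_mono power_mono) auto
      also have "\<dots> = q * L * c * (\<alpha> * \<Lambda>) ^ n"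
        by (simp only: mult.assoc power_add[symmetric] kn)
      also have "\<dots> \<le> ?b"
        using Lq c \<alpha> \<Lambda> by (intro mult_right_mono) (auto simp: algebra_simps)
      finally show "\<bar>?t k\<bar> \<le> ?b" .
    qed
    have "g (Suc n) 0 = pre (Suc n) \<theta> y"
      using P_pre[OF pre_K[OF y], of 0 "Suc n"] by (simp add: g_def Gn_eq)
    then have "\<bar>?r\<bar> \<le> q * dist (past (Suc n) \<theta>') (past (Suc n) \<theta>)"
      using ln_Df_lip[OF pre_in[OF y] pre_in[OF y], of "past (Suc n) \<theta>'" "Suc n" "past (Suc n) \<theta>" "Suc n"]
      by (simp del: funpow.simps)
    also have "\<dots> \<le> q * (c * \<alpha> ^ Suc n)"
      using a Lq unfolding asymptotic_def by (metis dist_commute mult_left_mono)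
    also have "\<dots> \<le> q * (c * \<alpha> ^ n)"
      using c \<alpha> Lq by (intro mult_left_mono power_decreasing) auto
    also have "\<dots> \<le> q * (c * (\<alpha> * \<Lambda>) ^ n)"
      using c \<alpha> \<Lambda> Lq by (intro mult_left_mono power_mono) auto
    also have "\<dots> \<le> ?b"
      using Lq c \<alpha> \<Lambda> by (simp add: mult.assoc[symmetric]) (simp add: algebra_simps)
    finally show "\<bar>?r\<bar> \<le> ?b" .
  qed
  finally show ?thesis
    by (simp add: algebra_simps)
qed

text \<open>The bounds sum to a convergent series, so the derivatives of the approximations converge
  uniformly to a positive limit.\<close>

lemma G_deriv:
  assumes a: "asymptotic c \<theta> \<theta>'"
  obtains D where "\<And>y. y \<in> Kf \<theta> \<Longrightarrow> (Gf \<theta> \<theta>' has_field_derivative D y) (at y within Kf \<theta>)"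
    and "continuous_on (Kf \<theta>) D" and "\<And>y. 0 < D y"
proof -
  let ?l = "ln_DGn \<theta> \<theta>'"
  let ?u = "\<lambda>n y. ?l (Suc n) y - ?l n y"
  define b where "b n = q * c * (L + 1) * (real (Suc n) * (\<alpha> * \<Lambda>) ^ n)" for n
  have b: "summable b"
    unfolding b_def using geometric_deriv_sums[of "\<alpha> * \<Lambda>"] \<alpha> \<Lambda>
    by (intro summable_mult sums_summable) auto
  have u: "\<bar>?u n y\<bar> \<le> b n" if "y \<in> Kf \<theta>" for n y
    unfolding b_def by (rule ln_DGn_step[OF a that])
  have b0: "0 \<le> b n" for n
    using a Lq \<alpha> \<Lambda> by (simp add: b_def asymptotic_def)
  define h where "h y = (\<Sum>n. ?u n y)" for y
  have l0: "?l 0 y = 0" for y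
    by (simp add: ln_DGn_def ln_DP_def)
  have tele: "(\<Sum>i<n. ?u i y) = ?l n y" for n y
    by (simp add: sum_lessThan_telescope[of "\<lambda>n. ?l n y"] l0)
  have lim: "uniform_limit (Kf \<theta>) ?l h sequentially"
    using Weierstrass_m_test[of "Kf \<theta>" ?u b] u b unfolding tele h_def by simp
  have h: "continuous_on (Kf \<theta>) h"
    by (rule uniform_limit_theorem[OF always_eventually[OF allI[OF ln_DGn_continuous]] lim])
      (rule sequentially_bot)
  have bound: "?l n y \<in> {- suminf b..suminf b}" if "y \<in> Kf \<theta>" for n y
  proof -
    have "\<bar>?l n y\<bar> \<le> (\<Sum>i<n. b i)"
      using order_trans[OF sum_abs sum_mono, of "{..<n}" "\<lambda>i. ?u i y" b] u[OF that]
      unfolding tele by blast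
    also have "\<dots> \<le> suminf b"
      using b b0 by (intro sum_le_suminf) auto
    finally show ?thesis by auto
  qed
  \<comment> \<open>The exponential is uniformly continuous only on bounded sets; the partial sums all lie
    in the compact interval of \<open>bound\<close>.\<close>
  have "uniform_limit (Kf \<theta>) (\<lambda>n y. exp (?l n y)) (\<lambda>y. exp (h y)) sequentially"
    by (rule uniform_limit_compose_uniformly_continuous_on
          [OF lim compact_uniformly_continuous[of "{- suminf b..suminf b}"]])
      (use bound in \<open>auto intro!: continuous_intros\<close>)
  then have "\<forall>\<^sub>F n in sequentially. \<forall>y\<in>Kf \<theta>. \<bar>exp (?l n y) - exp (h y)\<bar> < e" if "0 < e" for e
    using that by (simp add: uniform_limit_iff dist_real_def)
  then have ex: "\<forall>\<^sub>F n in sequentially. \<forall>y\<in>Kf \<theta>. \<bar>exp (?l n y) - exp (h y)\<bar> \<le> e"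
    if "0 < e" for e
    by (rule eventually_mono) (use that in \<open>auto intro: less_imp_le\<close>)
  have lo: "lo \<theta> \<in> Kf \<theta>"
    using lo_le_hi by (simp add: K_def)
  have "\<exists>g. \<forall>y\<in>Kf \<theta>. (\<lambda>n. Gn S M f \<theta> \<theta>' n y) \<longlonglongrightarrow> g y \<and>
      (g has_derivative (\<lambda>x. exp (h y) * x)) (at y within Kf \<theta>)"
  proof (rule has_derivative_sequence[where f = "\<lambda>n. Gn S M f \<theta> \<theta>' n"
        and f' = "\<lambda>n y x. exp (?l n y) * x", OF _ _ _ lo Gn_limit(1)[OF a lo]])
    show "convex (Kf \<theta>)" by (simp add: K_def)
    show "(Gn S M f \<theta> \<theta>' n has_derivative (\<lambda>x. exp (?l n y) * x)) (at y within Kf \<theta>)"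
      if "y \<in> Kf \<theta>" for n y
      using Gn_deriv[OF that] by (simp add: has_field_derivative_def)
    show "\<forall>\<^sub>F n in sequentially. \<forall>y\<in>Kf \<theta>. \<forall>x. norm (exp (?l n y) * x - exp (h y) * x) \<le> e * norm x"
      if "0 < e" for e
      using ex[OF that]
    proof (rule eventually_mono, intro ballI allI)
      fix n y x assume "\<forall>y\<in>Kf \<theta>. \<bar>exp (?l n y) - exp (h y)\<bar> \<le> e" "y \<in> Kf \<theta>"
      then have "\<bar>exp (?l n y) - exp (h y)\<bar> * \<bar>x\<bar> \<le> e * \<bar>x\<bar>"
        by (intro mult_right_mono) auto
      then show "norm (exp (?l n y) * x - exp (h y) * x) \<le> e * norm x"
        by (simp only: real_norm_def abs_mult[symmetric] left_diff_distrib)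
    qed
  qed
  then obtain g where g: "\<And>y. y \<in> Kf \<theta> \<Longrightarrow> (\<lambda>n. Gn S M f \<theta> \<theta>' n y) \<longlonglongrightarrow> g y"
    "\<And>y. y \<in> Kf \<theta> \<Longrightarrow> (g has_field_derivative exp (h y)) (at y within Kf \<theta>)"
    by (auto simp: has_field_derivative_def)
  have eq: "g y = Gf \<theta> \<theta>' y" if "y \<in> Kf \<theta>" for y
    using LIMSEQ_unique[OF g(1) Gn_limit(1)[OF a]] that by blast
  show thesis
  proof (rule that)
    show "(Gf \<theta> \<theta>' has_field_derivative exp (h y)) (at y within Kf \<theta>)" if "y \<in> Kf \<theta>" for y
      by (rule has_field_derivative_transform_within[OF g(2)[OF that], of 1]) (auto simp: eq that)
    show "continuous_on (Kf \<theta>) (\<lambda>y. exp (h y))"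
      by (intro continuous_on_exp h)
  qed simp
qed

lemma f_G_diffeo:
  assumes a: "asymptotic c \<theta> \<theta>'" and "lo \<theta> < hi \<theta>"
  shows "orientation_preserving_diffeo_on (Kf \<theta>) (Kf (S \<theta>')) (f \<theta>' \<circ> Gf \<theta> \<theta>')"
proof -
  obtain D where D: "\<And>y. y \<in> Kf \<theta> \<Longrightarrow> (Gf \<theta> \<theta>' has_field_derivative D y) (at y within Kf \<theta>)"
    "continuous_on (Kf \<theta>) D" "\<And>y. 0 < D y"
    using G_deriv[OF a] by blast
  have im: "Gf \<theta> \<theta>' ` Kf \<theta> = Kf \<theta>'"
    using G_bij[OF a] by (rule bij_betw_imp_surj_on)
  have GI: "Gf \<theta> \<theta>' y \<in> I" if "y \<in> Kf \<theta>" for y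
    using im K_sub that by blast
  show ?thesis
    unfolding K_def
  proof (rule orientation_preserving_diffeo_onI[OF \<open>lo \<theta> < hi \<theta>\<close>,
        where D = "\<lambda>y. Df \<theta>' (Gf \<theta> \<theta>' y) * D y"], fold K_def)
    show "strict_mono_on (Kf \<theta>) (f \<theta>' \<circ> Gf \<theta> \<theta>')"
      by (intro strict_mono_onI)
        (use strict_mono_onD[OF f_mono] strict_mono_onD[OF G_mono[OF a]] GI in force)
    show "(f \<theta>' \<circ> Gf \<theta> \<theta>') ` Kf \<theta> = Kf (S \<theta>')"
      by (simp only: image_comp[symmetric] im f_K_image)
    show "(f \<theta>' \<circ> Gf \<theta> \<theta>' has_field_derivative Df \<theta>' (Gf \<theta> \<theta>' y) * D y) (at y within Kf \<theta>)"
      if "y \<in> Kf \<theta>" for y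
    proof (rule DERIV_image_chain[OF _ D(1)[OF that]])
      show "(f \<theta>' has_field_derivative Df \<theta>' (Gf \<theta> \<theta>' y)) (at (Gf \<theta> \<theta>' y) within Gf \<theta> \<theta>' ` Kf \<theta>)"
        by (rule has_field_derivative_subset[OF f_deriv[OF GI[OF that]]]) (use GI in blast)
    qed
    have "continuous_on (Kf \<theta>) (Gf \<theta> \<theta>')"
      using D(1) by (rule DERIV_continuous_on)
    then show "continuous_on (Kf \<theta>) (\<lambda>y. Df \<theta>' (Gf \<theta> \<theta>' y) * D y)"
      by (intro continuous_on_mult D(2) continuous_on_compose2[OF Df_continuous])
        (simp_all add: im K_sub)
    show "0 < Df \<theta>' (Gf \<theta> \<theta>' y) * D y" if "y \<in> Kf \<theta>" for y
      using Df_pos[OF GI[OF that]] D(3) by simp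
  qed
qed

end

section \<open>Application to the skew product\<close>

lemma has_field_derivative_deriv_on:
  assumes "g differentiable_on X" "x \<in> X"
  shows "(g has_field_derivative deriv_on X g x) (at x within X)"
  using assms vector_derivative_works[of g "at x within X"]
  by (simp add: differentiable_on_def deriv_on_def has_real_derivative_iff_has_vector_derivative)

lemma SUP_ereal_finite:
  assumes "(SUP x\<in>A. ereal (g x)) < \<infinity>" "a \<in> A"
  shows "\<exists>B. (SUP x\<in>A. ereal (g x)) = ereal B \<and> (\<forall>x\<in>A. g x \<le> B)"
proof -
  have upper: "ereal (g x) \<le> (SUP x\<in>A. ereal (g x))" if "x \<in> A" for x
    using that by (rule SUP_upper)
  then obtain B where "(SUP x\<in>A. ereal (g x)) = ereal B"
    using assms(1) upper[OF assms(2)] by (cases "SUP x\<in>A. ereal (g x)") simp_all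
  then show ?thesis
    using upper by simp
qed

lemma le_cSUP_continuous:
  fixes g :: "real \<Rightarrow> real"
  assumes "continuous_on {a..b} g" "y \<in> {a..b}"
  shows "g y \<le> (SUP x\<in>{a..b}. g x)"
  by (intro cSUP_upper assms bounded_imp_bdd_above compact_imp_bounded compact_continuous_image)
    simp

text \<open>The extended real suprema of the hypotheses are finite, as required for real constants:
  \<open>Q\<close> because \<open>\<alpha>\<close> is positive and \<open>\<alpha> Q < 1\<close>.\<close>

lemma fibre_system_skew_product:
  assumes skew: "skew_product S M f" and A: "hypothesis_A M f"
    and \<alpha>: "0 < \<alpha>" "\<alpha> < 1" and C: "hypothesis_C M f \<alpha>"
  obtains \<Lambda> L q where "fibre_system S M f (\<lambda>\<theta>. deriv_on {-M..M} (f \<theta>)) \<alpha> \<Lambda> L q"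
proof -
  let ?I = "{-M..M}" and ?D = "\<lambda>\<theta>. deriv_on {-M..M} (f \<theta>)"
  have M: "0 < M" and S: "bij S" and range: "f \<theta> ` ?I \<subseteq> {-M<..<M}"
    and mono: "strict_mono_on ?I (f \<theta>)" and Ck: "Ck_on 3 ?I (f \<theta>)"
    and inf: "0 < (INF (\<theta>, y) \<in> UNIV \<times> ?I. ereal (?D \<theta> y))" for \<theta>
    using skew by (auto simp: skew_product_def)
  have f1: "f \<theta> differentiable_on ?I" and f2: "?D \<theta> differentiable_on ?I" for \<theta>
    using Ck[of \<theta>, unfolded Ck_on_def, THEN conjunct1, THEN spec, of 0]
      Ck[of \<theta>, unfolded Ck_on_def, THEN conjunct1, THEN spec, of 1] by simp_all
  have f_cont: "continuous_on ?I (f \<theta>)" and D_cont: "continuous_on ?I (?D \<theta>)" for \<theta>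
    using f1 f2 by (auto intro: differentiable_imp_continuous_on)
  obtain m where m: "0 < m" "ereal m < (INF (\<theta>, y) \<in> UNIV \<times> ?I. ereal (?D \<theta> y))"
    using ereal_dense2[OF inf] by (auto simp: zero_ereal_def)
  have D_ge: "m \<le> ?D \<theta> y" if "y \<in> ?I" for \<theta> y
    using less_INF_D[OF m(2), of "(\<theta>, y)"] that by simp
  have D_pos: "0 < ?D \<theta> y" if "y \<in> ?I" for \<theta> y
    using D_ge[OF that, of \<theta>] m(1) by simp
  have M_in: "(undefined, M) \<in> UNIV \<times> ?I"
    using M by simp
  have "Q M f < \<infinity>"
    using C \<alpha> by (cases "Q M f") (auto simp: hypothesis_C_def)
  then have "(SUP x\<in>UNIV \<times> ?I. ereal (?D (fst x) (snd x))) < \<infinity>"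
    by (simp add: Q_def case_prod_beta)
  from SUP_ereal_finite[OF this M_in] obtain Q0 where
    Q0: "Q M f = ereal Q0" "\<And>\<theta> y. y \<in> ?I \<Longrightarrow> ?D \<theta> y \<le> Q0"
    by (auto simp: Q_def case_prod_beta)
  have "(SUP x\<in>UNIV \<times> ?I. ereal \<bar>deriv_on ?I (\<lambda>z. ln (?D (fst x) z)) (snd x)\<bar>) < \<infinity>"
    using C by (simp add: hypothesis_C_def Q'_def case_prod_beta)
  from SUP_ereal_finite[OF this M_in]
  have "\<exists>Q1. \<forall>\<theta>. \<forall>y\<in>?I. \<bar>deriv_on ?I (\<lambda>z. ln (?D \<theta> z)) y\<bar> \<le> Q1"
    by auto
  then obtain Q1 where Q1: "\<And>\<theta> y. y \<in> ?I \<Longrightarrow> \<bar>deriv_on ?I (\<lambda>z. ln (?D \<theta> z)) y\<bar> \<le> Q1"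
    by blast
  have \<alpha>Q: "\<alpha> * Q0 < 1"
    using C by (simp add: hypothesis_C_def Q0(1) one_ereal_def)
  obtain L0 where L0: "(SUP y\<in>?I. \<bar>f \<theta> y - f \<theta>' y\<bar>) + (SUP y\<in>?I. \<bar>?D \<theta> y - ?D \<theta>' y\<bar>)
      \<le> L0 * dist \<theta> \<theta>'" for \<theta> \<theta>'
    using A unfolding hypothesis_A_def by blast
  have sup: "\<bar>f \<theta> y - f \<theta>' y\<bar> \<le> (SUP y\<in>?I. \<bar>f \<theta> y - f \<theta>' y\<bar>)"
    "\<bar>?D \<theta> y - ?D \<theta>' y\<bar> \<le> (SUP y\<in>?I. \<bar>?D \<theta> y - ?D \<theta>' y\<bar>)" if "y \<in> ?I" for \<theta> \<theta>' y
    using that by (intro le_cSUP_continuous continuous_intros f_cont D_cont; assumption)+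
  have L: "\<bar>f \<theta> y - f \<theta>' y\<bar> \<le> \<bar>L0\<bar> * dist \<theta> \<theta>'" "\<bar>?D \<theta> y - ?D \<theta>' y\<bar> \<le> \<bar>L0\<bar> * dist \<theta> \<theta>'"
    if "y \<in> ?I" for \<theta> \<theta>' y
  proof -
    have "L0 * dist \<theta> \<theta>' \<le> \<bar>L0\<bar> * dist \<theta> \<theta>'"
      by (rule mult_right_mono) simp_all
    moreover have "0 \<le> \<bar>f \<theta> y - f \<theta>' y\<bar>" "0 \<le> \<bar>?D \<theta> y - ?D \<theta>' y\<bar>"
      by simp_all
    ultimately show "\<bar>f \<theta> y - f \<theta>' y\<bar> \<le> \<bar>L0\<bar> * dist \<theta> \<theta>'"
      "\<bar>?D \<theta> y - ?D \<theta>' y\<bar> \<le> \<bar>L0\<bar> * dist \<theta> \<theta>'"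
      using sup[OF that, of \<theta> \<theta>'] L0[of \<theta> \<theta>'] by linarith+
  qed
  have ln_\<theta>: "\<bar>ln (?D \<theta> y) - ln (?D \<theta>' y)\<bar> \<le> \<bar>L0\<bar> / m * dist \<theta> \<theta>'" if y: "y \<in> ?I" for \<theta> \<theta>' y
  proof -
    have "ln (?D \<theta> y) - ln (?D \<theta>' y) \<le> \<bar>L0\<bar> / m * dist \<theta> \<theta>'" for \<theta> \<theta>'
    proof -
      have "ln (?D \<theta> y) - ln (?D \<theta>' y) \<le> (?D \<theta> y - ?D \<theta>' y) / ?D \<theta>' y"
        using D_pos[OF y] by (intro ln_diff_le)
      also have "\<dots> \<le> \<bar>L0\<bar> * dist \<theta> \<theta>' / m"
        using L(2)[OF y, of \<theta> \<theta>'] D_ge[OF y, of \<theta>'] m(1) by (intro frac_le) auto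
      finally show ?thesis by simp
    qed
    from this[of \<theta> \<theta>'] this[of \<theta>' \<theta>] show ?thesis
      by (simp add: dist_commute abs_le_iff)
  qed
  have ln_y: "\<bar>ln (?D \<theta> y) - ln (?D \<theta> z)\<bar> \<le> \<bar>Q1\<bar> * \<bar>y - z\<bar>" if "y \<in> ?I" "z \<in> ?I" for \<theta> y z
  proof -
    have diff: "(\<lambda>z. ln (?D \<theta> z)) differentiable_on ?I"
      unfolding differentiable_on_def
    proof
      fix x assume x: "x \<in> ?I"
      have "((\<lambda>z. ln (?D \<theta> z)) has_field_derivative
          1 / ?D \<theta> x * deriv_on ?I (?D \<theta>) x) (at x within ?I)"
        using D_pos[OF x, of \<theta>] has_field_derivative_deriv_on[OF f2 x, of \<theta>]
        by (auto intro!: derivative_eq_intros)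
      then show "(\<lambda>z. ln (?D \<theta> z)) differentiable at x within ?I"
        using real_differentiable_def by blast
    qed
    show ?thesis
      unfolding real_norm_def[symmetric]
    proof (rule field_differentiable_bound[OF _ has_field_derivative_deriv_on[OF diff] _ that])
      show "norm (deriv_on ?I (\<lambda>z. ln (?D \<theta> z)) x) \<le> norm Q1" if "x \<in> ?I" for x
        using Q1[OF that, of \<theta>] by simp
    qed simp_all
  qed
  have "fibre_system S M f ?D \<alpha> (max 1 Q0) \<bar>L0\<bar> (\<bar>Q1\<bar> + \<bar>L0\<bar> / m)"
  proof
    show "f \<theta> ` ?I \<subseteq> ?I" for \<theta>
      using range[of \<theta>] greaterThanLessThan_subseteq_atLeastAtMost_iff[of "- M" M "- M" M] by blast
    show "(f \<theta> has_field_derivative ?D \<theta> y) (at y within ?I)" if "y \<in> ?I" for \<theta> y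
      by (rule has_field_derivative_deriv_on[OF f1 that])
    show "?D \<theta> y \<le> max 1 Q0" if "y \<in> ?I" for \<theta> y
      using Q0(2)[OF that, of \<theta>] by simp
    show "\<alpha> * max 1 Q0 < 1"
      using \<alpha>Q \<alpha> by (simp add: max_def)
    show "\<bar>ln (?D \<theta> y) - ln (?D \<theta>' z)\<bar> \<le> (\<bar>Q1\<bar> + \<bar>L0\<bar> / m) * (dist \<theta> \<theta>' + \<bar>y - z\<bar>)"
      if "y \<in> ?I" "z \<in> ?I" for \<theta> \<theta>' y z
    proof -
      have "\<bar>ln (?D \<theta> y) - ln (?D \<theta>' z)\<bar> \<le> \<bar>L0\<bar> / m * dist \<theta> \<theta>' + \<bar>Q1\<bar> * \<bar>y - z\<bar>"
        using ln_\<theta>[OF that(1), of \<theta> \<theta>'] ln_y[OF that, of \<theta>'] by linarith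
      also have "\<dots> \<le> (\<bar>Q1\<bar> + \<bar>L0\<bar> / m) * dist \<theta> \<theta>' + (\<bar>Q1\<bar> + \<bar>L0\<bar> / m) * \<bar>y - z\<bar>"
        using m(1) by (intro add_mono mult_right_mono) auto
      finally show ?thesis
        by (simp add: distrib_left)
    qed
  qed (use M S mono \<alpha> m(1) D_pos L(1) in auto)
  then show thesis by (rule that)
qed

theorem theorem2p12:
  fixes S :: "'a::metric_space \<Rightarrow> 'a" and M :: real and f :: "'a \<Rightarrow> real \<Rightarrow> real"
    and Shat :: "complex \<Rightarrow> complex" and \<pi> :: "'a \<Rightarrow> complex" and \<sigma> :: "complex \<Rightarrow> 'a"
    and C \<alpha> :: real and \<theta> :: 'a
  assumes "skew_product S M f"
    and "hypothesis_A M f"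
    and "hypothesis_B S Shat \<pi> \<sigma> C \<alpha>"
    and "hypothesis_C M f \<alpha>"
  shows "fhat S M f \<pi> \<sigma> \<theta> ` Khat S M f \<pi> \<sigma> \<theta> = Khat S M f \<pi> \<sigma> (S \<theta>) \<and>
    (\<forall>y \<in> K S M f \<theta>.
       f \<theta> y = inv_into (K S M f (S \<theta>)) (Gproj S M f \<pi> \<sigma> (S \<theta>))
                 (fhat S M f \<pi> \<sigma> \<theta> (Gproj S M f \<pi> \<sigma> \<theta> y))) \<and>
    (\<forall>\<theta>'. \<pi> (S \<theta>) = \<pi> (S \<theta>') \<longrightarrow>
       Khat S M f \<pi> \<sigma> \<theta> = Khat S M f \<pi> \<sigma> \<theta>' \<and>
       (\<forall>y \<in> Khat S M f \<pi> \<sigma> \<theta>. fhat S M f \<pi> \<sigma> \<theta> y = fhat S M f \<pi> \<sigma> \<theta>' y)) \<and>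
    (\<theta> \<notin> pinch_points S M f \<longrightarrow>
       orientation_preserving_diffeo_on
         (Khat S M f \<pi> \<sigma> \<theta>) (Khat S M f \<pi> \<sigma> (S \<theta>)) (fhat S M f \<pi> \<sigma> \<theta>))"
proof -
  have \<alpha>: "0 < \<alpha>" "\<alpha> < 1" and "0 < C" and semi: "\<And>\<theta>. Shat (\<pi> \<theta>) = \<pi> (inv S \<theta>)"
    and \<pi>: "\<pi> \<in> measurable borel (restrict_space borel circle)"
    and \<pi>\<sigma>: "\<And>x. x \<in> circle \<Longrightarrow> \<pi> (\<sigma> x) = x"
    and stable: "\<And>\<theta>. \<sigma> (\<pi> \<theta>) \<in> local_stable_fibre S C \<alpha> \<theta>"
    using assms(3) by (auto simp: hypothesis_B_def)
  obtain \<Lambda> L q where "fibre_system S M f (\<lambda>\<theta>. deriv_on {-M..M} (f \<theta>)) \<alpha> \<Lambda> L q"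
    using fibre_system_skew_product[OF assms(1,2) \<alpha> assms(4)] .
  then interpret fibre_system S M f "\<lambda>\<theta>. deriv_on {-M..M} (f \<theta>)" \<alpha> \<Lambda> L q .
  have circle: "\<pi> \<theta> \<in> circle" for \<theta>
    using measurable_space[OF \<pi>, of \<theta>] by (simp add: space_restrict_space)
  have \<pi>_S: "\<pi> \<theta> = Shat (\<pi> (S \<theta>))" for \<theta>
    by (simp add: semi)
  have asym: "asymptotic ((C + 1) * dist \<theta> (\<sigma> (\<pi> \<theta>))) \<theta> (\<sigma> (\<pi> \<theta>))" for \<theta>
    unfolding asymptotic_def
  proof (intro conjI allI)
    show "0 \<le> (C + 1) * dist \<theta> (\<sigma> (\<pi> \<theta>))"
      using \<open>0 < C\<close> by simp
    fix n
    show "dist (past n \<theta>) (past n (\<sigma> (\<pi> \<theta>))) \<le> (C + 1) * dist \<theta> (\<sigma> (\<pi> \<theta>)) * \<alpha> ^ n"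
    proof (cases n)
      case 0
      then show ?thesis using \<open>0 < C\<close> by (simp add: distrib_right)
    next
      case (Suc k)
      then have "0 < n" by simp
      then have "dist (past n \<theta>) (past n (\<sigma> (\<pi> \<theta>))) \<le> C * \<alpha> ^ n * dist \<theta> (\<sigma> (\<pi> \<theta>))"
        using stable[of \<theta>] by (simp add: local_stable_fibre_def)
      also have "\<dots> \<le> (C + 1) * \<alpha> ^ n * dist \<theta> (\<sigma> (\<pi> \<theta>))"
        using \<alpha> by (intro mult_right_mono) auto
      finally show ?thesis by (simp add: mult_ac)
    qed
  qed
  have Khat: "Khat S M f \<pi> \<sigma> \<theta> = Kf (\<sigma> (\<pi> \<theta>))" for \<theta>
    unfolding Khat_def Gproj_def G_ends[OF asym] K_def ..
  define \<theta>0 where "\<theta>0 = \<sigma> (\<pi> \<theta>)"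
  define \<theta>1 where "\<theta>1 = inv S (\<sigma> (\<pi> (S \<theta>)))"
  have S\<theta>1: "S \<theta>1 = \<sigma> (\<pi> (S \<theta>))"
    by (simp add: \<theta>1_def)
  have fhat: "fhat S M f \<pi> \<sigma> \<theta> = f \<theta>1 \<circ> Gf \<theta>0 \<theta>1"
    by (simp add: fhat_def \<theta>0_def \<theta>1_def)
  \<comment> \<open>This is what places \<open>\<theta>0\<close> and \<open>\<theta>1\<close> on one stable fibre.\<close>
  have "\<pi> \<theta>1 = \<pi> \<theta>"
    by (metis S\<theta>1 \<pi>_S \<pi>\<sigma> circle)
  then obtain c where c: "asymptotic c \<theta>0 \<theta>1"
    using asymptotic_sym[OF asym[of \<theta>1]] by (auto simp: \<theta>0_def)
  obtain d where d: "asymptotic d \<theta> \<theta>0"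
    using asym by (auto simp: \<theta>0_def)
  have im: "fhat S M f \<pi> \<sigma> \<theta> ` Khat S M f \<pi> \<sigma> \<theta> = Khat S M f \<pi> \<sigma> (S \<theta>)"
    unfolding fhat Khat \<theta>0_def[symmetric] S\<theta>1[symmetric]
    by (simp only: image_comp[symmetric] bij_betw_imp_surj_on[OF G_bij[OF c]] f_K_image)
  have conj: "f \<theta> y = inv_into (Kf (S \<theta>)) (Gproj S M f \<pi> \<sigma> (S \<theta>))
      (fhat S M f \<pi> \<sigma> \<theta> (Gproj S M f \<pi> \<sigma> \<theta> y))" if y: "y \<in> Kf \<theta>" for y
  proof -
    have "fhat S M f \<pi> \<sigma> \<theta> (Gproj S M f \<pi> \<sigma> \<theta> y) = f \<theta>1 (Gf \<theta>0 \<theta>1 (Gf \<theta> \<theta>0 y))"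
      by (simp add: fhat Gproj_def \<theta>0_def)
    also have "\<dots> = f \<theta>1 (Gf \<theta> \<theta>1 y)"
      by (simp add: G_comp[OF d c y])
    also have "\<dots> = Gproj S M f \<pi> \<sigma> (S \<theta>) (f \<theta> y)"
      using G_f[OF asymptotic_trans[OF d c] y] by (simp add: Gproj_def S\<theta>1)
    finally show ?thesis
      using inv_into_f_f[OF bij_betw_imp_inj_on[OF G_bij[OF asym]] f_K[OF y]]
      by (simp add: Gproj_def)
  qed
  have factor: "Khat S M f \<pi> \<sigma> \<theta> = Khat S M f \<pi> \<sigma> \<theta>' \<and> fhat S M f \<pi> \<sigma> \<theta> = fhat S M f \<pi> \<sigma> \<theta>'"
    if "\<pi> (S \<theta>) = \<pi> (S \<theta>')" for \<theta>'
    using that \<pi>_S[of \<theta>] \<pi>_S[of \<theta>'] by (simp add: Khat fhat_def)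
  have diffeo: "orientation_preserving_diffeo_on
      (Khat S M f \<pi> \<sigma> \<theta>) (Khat S M f \<pi> \<sigma> (S \<theta>)) (fhat S M f \<pi> \<sigma> \<theta>)"
    if "\<theta> \<notin> pinch_points S M f"
  proof -
    have ends: "lo \<theta> \<in> Kf \<theta>" "hi \<theta> \<in> Kf \<theta>"
      using lo_le_hi by (simp_all add: K_def)
    have "lo \<theta> < hi \<theta>"
      using that lo_le_hi[of \<theta>] by (simp add: pinch_points_def)
    then have "lo \<theta>0 < hi \<theta>0"
      using strict_mono_onD[OF G_mono[OF d] ends] by (simp add: G_ends[OF d])
    from f_G_diffeo[OF c this] show ?thesis
      by (simp only: Khat fhat \<theta>0_def[symmetric] S\<theta>1)
  qed
  show ?thesis
    by (intro conjI ballI allI impI)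
      (fact im, erule conj, (drule factor, simp)+, erule diffeo)
qed

end
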